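(* Let $t_1, t_2, t_3, \ldots$ be a countably infinite set of commuting indeterminates. Then, as formal power series, \[ \prod_{k=1}^\infty \frac{1}{1-\left(t_1^k+t_2^k+t_3^k+\cdots\right)} \;=\; \sum_{\lambda}\sum_{\boldsymbol{\mu}} \left(c^{\lambda}_{\boldsymbol{\mu}}\right)^2 \,\boldsymbol{t}^{\boldsymbol{\mu}}, \] where the outer sum is over all partitions $\lambda$ (with non-negative integer parts), the inner sum is over all finitely supported sequences of partitions $\boldsymbol{\mu}=(\mu^{(1)},\mu^{(2)},\mu^{(3)},\ldots)$ (all but finitely many $\mu^{(j)}$ empty), and $\boldsymbol{t}^{\boldsymbol{\mu}} = t_1^{|\mu^{(1)}|}t_2^{|\mu^{(2)}|}t_3^{|\mu^{(3)}|}\cdots$.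
   Context: For a partition $\nu$, $|\nu|$ denotes the sum of its parts. For a finite (or finitely supported) sequence of partitions $\boldsymbol{\mu}=(\mu^{(1)},\ldots,\mu^{(m)})$, the generalized Littlewood–Richardson coefficient $c^{\lambda}_{\boldsymbol{\mu}}$ is the multiplicity of the irreducible polynomial representation $F^{\lambda}_n$ of $\mathrm{GL}_n(\mathbb{C})$ with highest weight $\lambda$ in the tensor product $F^{\mu^{(1)}}_n\otimes\cdots\otimes F^{\mu^{(m)}}_n$ under the diagonal action, for $n$ sufficiently large; equivalently, it is defined by the expansion of products of Schur functions $s_{\mu^{(1)}}\cdots s_{\mu^{(m)}}=\sum_\lambda c^{\lambda}_{\boldsymbol{\mu}}\, s_\lambda$. In particular $c^{\lambda}_{\boldsymbol{\mu}}=0$ unless $|\lambda|=\sum_j|\mu^{(j)}|$. *)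

theory Defs
  imports "HOL-Library.Poly_Mapping"
begin

text \<open>Monomials in the countably many commuting indeterminates x_0, x_1, x_2, ...
  are exponent vectors of type nat =>0 nat (finitely supported).
  A formal power series with integer coefficients is its coefficient function.\<close>

type_synonym monom = "nat \<Rightarrow>\<^sub>0 nat"
type_synonym mfps = "monom \<Rightarrow> int"

definition mone :: mfps where
  "mone m = (if m = 0 then 1 else 0)"

definition mmult :: "mfps \<Rightarrow> mfps \<Rightarrow> mfps" where
  "mmult f g m = (\<Sum>(a, b) \<in> {(a, b). a + b = m}. f a * g b)"

definition msub :: "mfps \<Rightarrow> mfps \<Rightarrow> mfps" where
  "msub f g m = f m - g m"

text \<open>Multiplicative inverse 1/f (exists and is unique when f has constant term 1).\<close>
definition minv :: "mfps \<Rightarrow> mfps" where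
  "minv f = (THE g. mmult g f = mone)"

fun mprod_list :: "mfps list \<Rightarrow> mfps" where
  "mprod_list [] = mone"
| "mprod_list (f # fs) = mmult f (mprod_list fs)"

definition mprod_inf :: "(nat \<Rightarrow> mfps) \<Rightarrow> mfps" where
  "mprod_inf F m = (THE c. \<exists>N0. \<forall>N\<ge>N0. mprod_list (map F [1..<Suc N]) m = c)"

text \<open>Power sum p_k = sum_i x_i^k (for k >= 1).\<close>
definition psum :: "nat \<Rightarrow> mfps" where
  "psum k m = (if \<exists>i. m = Poly_Mapping.single i k then 1 else 0)"

definition is_partition :: "nat list \<Rightarrow> bool" where
  "is_partition lam \<longleftrightarrow> sorted_wrt (\<ge>) lam \<and> 0 \<notin> set lam"

definition cells :: "nat list \<Rightarrow> (nat \<times> nat) set" where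
  "cells lam = {(i, j). i < length lam \<and> j < lam ! i}"

definition ssyt :: "nat list \<Rightarrow> (nat \<times> nat \<Rightarrow> nat) \<Rightarrow> bool" where
  "ssyt lam T \<longleftrightarrow>
     (\<forall>c. c \<notin> cells lam \<longrightarrow> T c = 0) \<and>
     (\<forall>i j. (i, Suc j) \<in> cells lam \<longrightarrow> T (i, j) \<le> T (i, Suc j)) \<and>
     (\<forall>i j. (Suc i, j) \<in> cells lam \<longrightarrow> T (i, j) < T (Suc i, j))"

definition tab_content :: "nat list \<Rightarrow> (nat \<times> nat \<Rightarrow> nat) \<Rightarrow> monom" where
  "tab_content lam T = (\<Sum>c \<in> cells lam. Poly_Mapping.single (T c) 1)"

definition schur :: "nat list \<Rightarrow> mfps" where
  "schur lam m = int (card {T. ssyt lam T \<and> tab_content lam T = m})"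

definition seq_len :: "(nat \<Rightarrow> nat list) \<Rightarrow> nat" where
  "seq_len mus = (LEAST N. \<forall>j\<ge>N. mus j = [])"

definition gen_lr :: "nat list \<Rightarrow> (nat \<Rightarrow> nat list) \<Rightarrow> int" where
  "gen_lr lam mus =
     (THE c :: nat list \<Rightarrow> int.
        (\<forall>nu. c nu \<noteq> 0 \<longrightarrow> is_partition nu) \<and> finite {nu. c nu \<noteq> 0} \<and>
        mprod_list (map (\<lambda>j. schur (mus j)) [0..<seq_len mus])
          = (\<lambda>m. \<Sum>nu \<in> {nu. c nu \<noteq> 0}. c nu * schur nu m)) lam"

end

theory Submission
  imports Defs "HOL-Library.Product_Plus" "HOL-Combinatorics.Permutations"
    "Jordan_Normal_Form.Determinant"
begin

text \<open>
  Write \<open>K\<close> for the Kostka matrix, indexed by partitions of \<open>n = |m|\<close>, and \<open>R\<close> for the matrix of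
  coefficients of the power sum products \<open>p\<^sub>\<rho>\<close> at monomials \<open>x\<^sup>\<alpha>\<close>. By the Cauchy identity, the sum over
  \<open>\<mu>\<close> with \<open>|\<mu>\<^sub>j| = m\<^sub>j\<close> of \<open>\<Prod> s\<^sub>\<mu>\<^sub>j(x) s\<^sub>\<mu>\<^sub>j(y)\<close> has as its coefficient at \<open>x\<^sup>\<alpha> y\<^sup>\<beta>\<close> the number of
  nonnegative integer 3-tensors with margins \<open>m, \<alpha>, \<beta>\<close>, which is \<open>\<Sum>\<^sub>\<rho> p\<^sub>\<rho>[m] R\<^sub>\<rho>\<^sub>\<alpha> R\<^sub>\<rho>\<^sub>\<beta> / z\<^sub>\<rho>\<close>. Passing to
  Schur coefficients multiplies by the inverse of \<open>K\<close> on both sides, so the sum of the squared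
  Littlewood--Richardson coefficients is the trace \<open>\<Sum>\<^sub>\<rho> p\<^sub>\<rho>[m] \<Sum>\<^sub>\<lambda> B\<^sub>\<rho>\<^sub>\<lambda>\<^sup>2 / z\<^sub>\<rho>\<close> with \<open>B = R K\<^sup>-\<^sup>1\<close>.
  The case of a single nonempty \<open>\<mu>\<^sub>j\<close> says that \<open>B\<close> has orthonormal columns with respect to the weights
  \<open>1 / z\<^sub>\<rho>\<close>; as \<open>B\<close> is square, \<open>\<Sum>\<^sub>\<lambda> B\<^sub>\<rho>\<^sub>\<lambda>\<^sup>2 = z\<^sub>\<rho>\<close>, and what remains is \<open>\<Sum>\<^sub>\<rho> p\<^sub>\<rho>[m]\<close>, the coefficient of the
  product.

  Symmetry of Schur functions and the Cauchy identity are both obtained from local commutation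
  rules for adding and removing horizontal strips.
\<close>

section \<open>Convolution algebra of power series in infinitely many variables, and total
  degree\<close>

section \<open>Formal power series\<close>

text \<open>Polymorphic because pairs of monomials are split as well, when the two margins of a
  matrix are convolved together.\<close>

definition splits :: "'a::plus \<Rightarrow> ('a \<times> 'a) set" where
  "splits m = {(a, b). a + b = m}"

lemma in_splits [simp]: "(a, b) \<in> splits m \<longleftrightarrow> a + b = m"
  by (simp add: splits_def)

text \<open>A divisor of \<open>m\<close> vanishes off the keys of \<open>m\<close> and is bounded
  on them.\<close>

lemma finite_lookup_le:
  fixes m :: "'a \<Rightarrow>\<^sub>0 nat"
  shows "finite {a. \<forall>i. Poly_Mapping.lookup a i \<le> Poly_Mapping.lookup m i}" (is "finite ?A")
proof -
  let ?B = "\<Union>i\<in>Poly_Mapping.keys m. {..Poly_Mapping.lookup m i}"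
  have in_B: "Poly_Mapping.lookup a i \<in> ?B" if "a \<in> ?A" "i \<in> Poly_Mapping.keys m" for a i
    using that by blast
  have outside: "Poly_Mapping.lookup a i = 0" if "a \<in> ?A" "i \<notin> Poly_Mapping.keys m" for a i
    using that by (metis in_keys_iff le_zero_eq mem_Collect_eq)
  have "Poly_Mapping.lookup ` ?A \<subseteq>
    {f. \<forall>i. (i \<in> Poly_Mapping.keys m \<longrightarrow> f i \<in> ?B) \<and> (i \<notin> Poly_Mapping.keys m \<longrightarrow> f i = 0)}"
    by (intro image_subsetI CollectI allI conjI impI in_B outside) auto
  then have "finite (Poly_Mapping.lookup ` ?A)"
    by (rule finite_subset) (intro finite_set_of_finite_funs; simp)
  then show ?thesis
    by (rule finite_imageD) (simp add: inj_on_def poly_mapping.lookup_inject)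
qed

lemma finite_splits_monom [simp, intro]: "finite (splits (m :: monom))"
proof -
  let ?A = "{a. \<forall>i. Poly_Mapping.lookup a i \<le> Poly_Mapping.lookup m i}"
  have "splits m \<subseteq> ?A \<times> ?A"
    by (auto simp: splits_def lookup_add)
  then show ?thesis
    by (rule finite_subset) (simp add: finite_lookup_le)
qed

lemma splits_Pair:
  "splits (a, b) = (\<lambda>((a1, a2), (b1, b2)). ((a1, b1), (a2, b2))) ` (splits a \<times> splits b)"
  by (auto simp: splits_def image_iff)

lemma finite_splits_monom_Pair [simp, intro]: "finite (splits (p :: monom \<times> monom))"
  by (cases p) (simp add: splits_Pair)

lemma mmult_splits: "mmult f g m = (\<Sum>(a, b)\<in>splits m. f a * g b)"
  by (simp add: mmult_def splits_def)

lemma mmult_comm: "mmult f g = mmult g f"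
proof
  fix m show "mmult f g m = mmult g f m"
    unfolding mmult_splits
    by (rule sum.reindex_bij_witness[of _ "\<lambda>(a, b). (b, a)" "\<lambda>(a, b). (b, a)"])
       (auto simp: add.commute mult.commute)
qed

lemma mmult_assoc: "mmult (mmult f g) h = mmult f (mmult g h)"
proof
  fix m
  have "mmult (mmult f g) h m = (\<Sum>(p, c)\<in>splits m. \<Sum>(a, b)\<in>splits p. f a * g b * h c)"
    by (simp add: mmult_splits sum_distrib_right case_prod_unfold)
  also have "\<dots> = (\<Sum>((p, c), (a, b))\<in>(SIGMA x:splits m. splits (fst x)). f a * g b * h c)"
    by (subst sum.Sigma[symmetric]) (auto simp: case_prod_unfold)
  also have "\<dots> = (\<Sum>((a, q), (b, c))\<in>(SIGMA x:splits m. splits (snd x)). f a * g b * h c)"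
    by (rule sum.reindex_bij_witness[of _ "\<lambda>((a, q), (b, c)). ((a + b, c), (a, b))"
          "\<lambda>((p, c), (a, b)). ((a, b + c), (b, c))"]) (auto simp: add.assoc)
  also have "\<dots> = (\<Sum>(a, q)\<in>splits m. \<Sum>(b, c)\<in>splits q. f a * g b * h c)"
    by (subst sum.Sigma[symmetric]) (auto simp: case_prod_unfold)
  also have "\<dots> = mmult f (mmult g h) m"
    by (simp add: mmult_splits sum_distrib_left case_prod_unfold mult.assoc)
  finally show "mmult (mmult f g) h m = mmult f (mmult g h) m" .
qed

lemma mmult_mone_left [simp]: "mmult mone f = f"
proof
  fix m
  have "mmult mone f m = (\<Sum>x\<in>{(0, m)}. case x of (a, b) \<Rightarrow> mone a * f b)"
    unfolding mmult_splits by (rule sum.mono_neutral_right) (auto simp: mone_def split: if_splits)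
  then show "mmult mone f m = f m" by (simp add: mone_def)
qed

lemma mmult_mone_right [simp]: "mmult f mone = f"
  by (subst mmult_comm) simp

lemma mmult_msub_right: "mmult f (msub g h) = msub (mmult f g) (mmult f h)"
  by (simp add: fun_eq_iff mmult_splits msub_def case_prod_unfold right_diff_distrib sum_subtractf)

lemma mmult_sum_right:
  "mmult f (\<lambda>m. \<Sum>x\<in>A. g x m) m = (\<Sum>x\<in>A. mmult f (g x) m)"
  unfolding mmult_splits case_prod_unfold sum_distrib_left by (rule sum.swap)

lemma mprod_list_append: "mprod_list (xs @ ys) = mmult (mprod_list xs) (mprod_list ys)"
  by (induction xs) (simp_all add: mmult_assoc)

lemma mprod_list_cong_mset: "mset xs = mset ys \<Longrightarrow> mprod_list xs = mprod_list ys"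
proof (induction xs arbitrary: ys)
  case (Cons x xs)
  then have "x \<in> set ys" by (metis list.set_intros(1) mset_eq_setD)
  then obtain us vs where ys: "ys = us @ x # vs" by (auto simp: in_set_conv_decomp)
  have "mprod_list xs = mprod_list (us @ vs)"
    using Cons.prems by (intro Cons.IH) (simp add: ys)
  then show ?case
    by (simp add: ys mprod_list_append mmult_assoc[symmetric] mmult_comm[of "mprod_list us" x])
qed simp

text \<open>Convolution is a commutative monoid, so an inverse is unique and any witness settles the
  \<open>THE\<close> in \<open>minv\<close>.\<close>

lemma minv_eqI:
  assumes "mmult g f = mone"
  shows "minv f = g"
  unfolding minv_def
proof (rule the_equality)
  fix g' assume "mmult g' f = mone"
  have "g' = mmult g' (mmult f g)"
    using assms by (simp add: mmult_comm[of f g])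
  also have "\<dots> = g"
    by (simp add: mmult_assoc[symmetric] \<open>mmult g' f = mone\<close>)
  finally show "g' = g" .
qed fact

definition mdeg :: "monom \<Rightarrow> nat" where
  "mdeg m = (\<Sum>i\<in>Poly_Mapping.keys m. Poly_Mapping.lookup m i)"

lemma mdeg_superset:
  "finite A \<Longrightarrow> Poly_Mapping.keys m \<subseteq> A \<Longrightarrow> mdeg m = (\<Sum>i\<in>A. Poly_Mapping.lookup m i)"
  unfolding mdeg_def by (rule sum.mono_neutral_left) (auto simp: in_keys_iff)

lemma mdeg_add [simp]: "mdeg (a + b) = mdeg a + mdeg b"
proof -
  let ?A = "Poly_Mapping.keys a \<union> Poly_Mapping.keys b"
  have "mdeg (a + b) = (\<Sum>i\<in>?A. Poly_Mapping.lookup (a + b) i)"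
    using keys_add[of a b] by (intro mdeg_superset) auto
  also have "\<dots> = mdeg a + mdeg b"
    by (simp add: lookup_add sum.distrib mdeg_superset[of ?A a] mdeg_superset[of ?A b])
  finally show ?thesis .
qed

lemma mdeg_zero [simp]: "mdeg 0 = 0"
  by (simp add: mdeg_def)

lemma mdeg_single [simp]: "mdeg (Poly_Mapping.single i k) = k"
  by (simp add: mdeg_def)

lemma mdeg_sum: "mdeg (sum f A) = (\<Sum>x\<in>A. mdeg (f x))"
  by (induction A rule: infinite_finite_induct) auto

lemma lookup_le_mdeg: "Poly_Mapping.lookup m i \<le> mdeg m"
proof (cases "i \<in> Poly_Mapping.keys m")
  case True
  then show ?thesis unfolding mdeg_def by (intro member_le_sum) auto
qed (simp add: in_keys_iff)

lemma mdeg_eq_0_iff [simp]: "mdeg m = 0 \<longleftrightarrow> m = 0"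
  using lookup_le_mdeg[of m] by (auto intro!: poly_mapping_eqI)

text \<open>Adjoins one variable at a time. \<open>N\<close> bounds the variables instead of
  counting those present, since \<open>k\<close> may be 0, and \<open>P\<close> depends on
  \<open>N\<close> so that products of \<open>N\<close> factors can be treated too.\<close>

lemma monom_bounded_induct [consumes 1, case_names zero step]:
  assumes "Poly_Mapping.keys m \<subseteq> {..<N}"
    and "P 0 0"
    and "\<And>N m k. Poly_Mapping.keys m \<subseteq> {..<N} \<Longrightarrow> P N m \<Longrightarrow> P (Suc N) (m + Poly_Mapping.single N k)"
  shows "P N (m :: monom)"
  using assms(1)
proof (induction N arbitrary: m)
  case 0
  then have "m = 0" by (auto intro!: poly_mapping_eqI simp: in_keys_iff)
  then show ?case using assms(2) by simp
next
  case (Suc N)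
  let ?k = "Poly_Mapping.lookup m N" and ?m = "Poly_Mapping.update N 0 m"
  have m: "m = ?m + Poly_Mapping.single N ?k"
    by (auto intro!: poly_mapping_eqI simp: lookup_add lookup_update lookup_single when_def)
  have "Poly_Mapping.keys ?m \<subseteq> {..<N}"
    using Suc.prems by (auto simp: keys_update less_Suc_eq)
  then show ?case
    by (subst m) (intro assms(3) Suc.IH; simp)
qed

lemma keys_subset_lessThan_ex: "\<exists>N. Poly_Mapping.keys (m :: monom) \<subseteq> {..<N}"
  using in_keys_less_degree by blast

section \<open>Evaluation of the infinite product as the sum of all power sum products\<close>

section \<open>The product side\<close>

definition parts :: "nat \<Rightarrow> nat list set" where
  "parts n = {lam. is_partition lam \<and> sum_list lam = n}"

lemma length_le_sum_list: "0 \<notin> set xs \<Longrightarrow> length xs \<le> sum_list (xs :: nat list)"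
proof (induction xs)
  case (Cons x xs)
  then have "length xs \<le> sum_list xs" "0 < x" by auto
  then show ?case by simp
qed simp

lemma finite_nat_lists_sum [simp]: "finite {xs :: nat list. 0 \<notin> set xs \<and> sum_list xs = n}"
proof -
  have "{xs :: nat list. 0 \<notin> set xs \<and> sum_list xs = n} \<subseteq> {xs. set xs \<subseteq> {..n} \<and> length xs \<le> n}"
    using length_le_sum_list member_le_sum_list by fastforce
  then show ?thesis by (rule finite_subset) (simp add: finite_lists_length_le)
qed

lemma finite_parts [simp, intro]: "finite (parts n)"
  by (rule finite_subset[OF _ finite_nat_lists_sum[of n]]) (auto simp: parts_def is_partition_def)

definition homog :: "nat \<Rightarrow> mfps \<Rightarrow> bool" where
  "homog n f \<longleftrightarrow> (\<forall>m. f m \<noteq> 0 \<longrightarrow> mdeg m = n)"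

lemma homogD: "homog n f \<Longrightarrow> mdeg m \<noteq> n \<Longrightarrow> f m = 0"
  by (auto simp: homog_def)

lemma homog_mone: "homog 0 mone"
  by (simp add: homog_def mone_def)

lemma homog_mmult:
  assumes "homog i f" "homog j g"
  shows "homog (i + j) (mmult f g)"
  unfolding homog_def
proof (intro allI impI)
  fix m assume "mmult f g m \<noteq> 0"
  then obtain x where "x \<in> splits m" "(case x of (a, b) \<Rightarrow> f a * g b) \<noteq> 0"
    unfolding mmult_splits by (meson sum.not_neutral_contains_not_neutral)
  then show "mdeg m = i + j"
    using assms by (cases x) (auto simp: homog_def)
qed

lemma homog_mprod_list:
  "list_all2 homog ns fs \<Longrightarrow> homog (sum_list ns) (mprod_list fs)"
  by (induction rule: list_all2_induct) (auto intro: homog_mmult homog_mone)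

definition psums :: "nat list \<Rightarrow> mfps" where
  "psums rho = mprod_list (map psum rho)"

lemma homog_psum: "homog k (psum k)"
  by (auto simp: homog_def psum_def split: if_splits)

lemma psums_Cons: "psums (k # rho) = mmult (psum k) (psums rho)"
  by (simp add: psums_def)

text \<open>For a set \<open>S\<close> of positive numbers this is the product of
  \<open>1 / (1 - p\<^sub>k)\<close> over \<open>k\<close> in \<open>S\<close>. By homogeneity only
  partitions of the degree of \<open>m\<close> reach the coefficient at \<open>m\<close>.\<close>

definition psums_gf :: "nat set \<Rightarrow> mfps" where
  "psums_gf S m = (\<Sum>rho\<in>{rho \<in> parts (mdeg m). set rho \<subseteq> S}. psums rho m)"

text \<open>As \<open>k\<close> exceeds all other allowed parts, a decreasing list that contains
  \<open>k\<close> starts with it, and its tail may contain \<open>k\<close> again. This is the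
  recursion of the geometric series in \<open>p\<^sub>k\<close> on index sets.\<close>

lemma parts_insert:
  assumes "0 < k" "\<forall>s\<in>S. s < k"
  shows "{rho \<in> parts n. set rho \<subseteq> insert k S} =
    {rho \<in> parts n. set rho \<subseteq> S} \<union>
    (if k \<le> n then (#) k ` {rho \<in> parts (n - k). set rho \<subseteq> insert k S} else {})"
proof (intro equalityI subsetI)
  fix rho assume r: "rho \<in> {rho \<in> parts n. set rho \<subseteq> insert k S}"
  show "rho \<in> {rho \<in> parts n. set rho \<subseteq> S} \<union>
    (if k \<le> n then (#) k ` {rho \<in> parts (n - k). set rho \<subseteq> insert k S} else {})"
  proof (cases "k \<in> set rho")
    case True
    then obtain x xs where rho: "rho = x # xs" by (cases rho) auto
    have "x = k"
    proof (rule ccontr)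
      assume "x \<noteq> k"
      then have "x < k" "k \<in> set xs" using r True assms by (auto simp: rho)
      then show False using r by (auto simp: rho parts_def is_partition_def)
    qed
    then show ?thesis using r by (auto simp: rho parts_def is_partition_def)
  next
    case False
    then show ?thesis using r by auto
  qed
next
  fix rho assume "rho \<in> {rho \<in> parts n. set rho \<subseteq> S} \<union>
    (if k \<le> n then (#) k ` {rho \<in> parts (n - k). set rho \<subseteq> insert k S} else {})"
  then show "rho \<in> {rho \<in> parts n. set rho \<subseteq> insert k S}"
    using assms by (auto simp: parts_def is_partition_def split: if_splits) fastforce+
qed

lemma mmult_psum_psums_gf:
  "mmult (psum k) (psums_gf S) m =
    (if k \<le> mdeg m then \<Sum>rho\<in>{rho \<in> parts (mdeg m - k). set rho \<subseteq> S}. psums (k # rho) m else 0)"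
proof (cases "k \<le> mdeg m")
  case True
  \<comment> \<open>Where \<open>psum k\<close> is nonzero the other factor has degree
    \<open>mdeg m - k\<close>. This fixes the index set, so that the sum can be pulled out of the
    convolution.\<close>
  have "mmult (psum k) (psums_gf S) m =
      mmult (psum k) (\<lambda>b. \<Sum>rho\<in>{rho \<in> parts (mdeg m - k). set rho \<subseteq> S}. psums rho b) m"
    unfolding mmult_splits
  proof (intro sum.cong refl, clarify)
    fix a b assume "(a, b) \<in> splits m"
    then have "mdeg a = k \<Longrightarrow> mdeg b = mdeg m - k" by auto
    then show "psum k a * psums_gf S b =
        psum k a * (\<Sum>rho\<in>{rho \<in> parts (mdeg m - k). set rho \<subseteq> S}. psums rho b)"
      using homogD[OF homog_psum, of a k] by (cases "mdeg a = k") (auto simp: psums_gf_def)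
  qed
  with True show ?thesis by (simp add: mmult_sum_right psums_Cons)
next
  case False
  then have "psum k a = 0" if "(a, b) \<in> splits m" for a b
    using that by (intro homogD[OF homog_psum]) auto
  then show ?thesis using False by (auto simp: mmult_splits intro!: sum.neutral)
qed

text \<open>Multiplying by \<open>1 - p\<^sub>k\<close> cancels exactly the partitions that contain
  \<open>k\<close>.\<close>

lemma psums_gf_insert:
  assumes "0 < k" "\<forall>s\<in>S. s < k"
  shows "mmult (psums_gf (insert k S)) (msub mone (psum k)) = psums_gf S"
proof -
  have "psums_gf (insert k S) m = psums_gf S m + mmult (psum k) (psums_gf (insert k S)) m" for m
  proof -
    let ?A = "{rho \<in> parts (mdeg m). set rho \<subseteq> S}"
    let ?B = "if k \<le> mdeg m then (#) k ` {rho \<in> parts (mdeg m - k). set rho \<subseteq> insert k S} else {}"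
    have "psums_gf (insert k S) m = (\<Sum>rho\<in>?A \<union> ?B. psums rho m)"
      by (subst psums_gf_def, subst parts_insert[OF assms]) (rule refl)
    also have "\<dots> = (\<Sum>rho\<in>?A. psums rho m) + (\<Sum>rho\<in>?B. psums rho m)"
      using assms by (intro sum.union_disjoint) auto
    also have "(\<Sum>rho\<in>?B. psums rho m) = mmult (psum k) (psums_gf (insert k S)) m"
      by (simp add: mmult_psum_psums_gf sum.reindex)
    finally show ?thesis by (simp add: psums_gf_def)
  qed
  then show ?thesis
    by (simp add: fun_eq_iff mmult_msub_right msub_def mmult_comm[of "psum k"])
qed

lemma psums_gf_empty: "psums_gf {} = mone"
proof
  fix m
  have "{rho \<in> parts (mdeg m). set rho \<subseteq> {}} = (if m = 0 then {[]} else {})"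
    using mdeg_eq_0_iff[of m] by (auto simp: parts_def is_partition_def)
  then show "psums_gf {} m = mone m"
    by (simp add: psums_gf_def mone_def psums_def)
qed

lemma minv_one_minus_psum:
  assumes "0 < k"
  shows "minv (msub mone (psum k)) = psums_gf {k}"
  using psums_gf_insert[of k "{}"] assms by (intro minv_eqI) (simp add: psums_gf_empty)

lemma mprod_list_psums_gf:
  "mprod_list (map (\<lambda>k. minv (msub mone (psum k))) [1..<Suc N]) = psums_gf {1..N}"
proof (induction N)
  case 0
  then show ?case by (simp add: psums_gf_empty)
next
  case (Suc N)
  let ?f = "msub mone (psum (Suc N))"
  have ins: "insert (Suc N) {1..N} = {1..Suc N}" by auto
  have "mprod_list (map (\<lambda>k. minv (msub mone (psum k))) [1..<Suc (Suc N)]) =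
      mmult (psums_gf {1..N}) (psums_gf {Suc N})"
    using Suc.IH minv_one_minus_psum[of "Suc N"] by (simp add: mprod_list_append)
  \<comment> \<open>The shorter series is the longer one times \<open>?f\<close>, which the new
    factor inverts.\<close>
  also have "psums_gf {1..N} = mmult (psums_gf {1..Suc N}) ?f"
    using psums_gf_insert[of "Suc N" "{1..N}"] unfolding ins by auto
  also have "mmult (mmult (psums_gf {1..Suc N}) ?f) (psums_gf {Suc N}) =
      mmult (psums_gf {1..Suc N}) (mmult (psums_gf {Suc N}) ?f)"
    by (simp add: mmult_assoc mmult_comm[of "?f"])
  also have "mmult (psums_gf {Suc N}) ?f = mone"
    using psums_gf_insert[of "Suc N" "{}"] by (simp add: psums_gf_empty)
  finally show ?case by simp
qed

text \<open>No part of a partition of \<open>mdeg m\<close> exceeds \<open>mdeg m\<close>, so the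
  coefficient at \<open>m\<close> is constant from \<open>N = mdeg m\<close> on.\<close>

lemma mprod_inf_psum:
  "mprod_inf (\<lambda>k. minv (msub mone (psum k))) m = (\<Sum>rho\<in>parts (mdeg m). psums rho m)"
  unfolding mprod_inf_def mprod_list_psums_gf
proof (rule the_equality)
  have eq: "psums_gf {1..N} m = (\<Sum>rho\<in>parts (mdeg m). psums rho m)" if "N \<ge> mdeg m" for N
  proof -
    have "x \<in> {1..N}" if "rho \<in> parts (mdeg m)" "x \<in> set rho" for rho x
      using that member_le_sum_list[of x rho] \<open>N \<ge> mdeg m\<close>
      by (cases "x = 0") (auto simp: parts_def is_partition_def)
    then have "{rho \<in> parts (mdeg m). set rho \<subseteq> {1..N}} = parts (mdeg m)"
      by blast
    then show ?thesis by (simp add: psums_gf_def)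
  qed
  then show "\<exists>N0. \<forall>N\<ge>N0. psums_gf {1..N} m = (\<Sum>rho\<in>parts (mdeg m). psums rho m)"
    by blast
  fix c assume "\<exists>N0. \<forall>N\<ge>N0. psums_gf {1..N} m = c"
  then obtain N0 where "\<forall>N\<ge>N0. psums_gf {1..N} m = c" ..
  then have "psums_gf {1..max N0 (mdeg m)} m = c" by simp
  then show "c = (\<Sum>rho\<in>parts (mdeg m). psums rho m)"
    using eq[of "max N0 (mdeg m)"] by simp
qed

section \<open>Horizontal strips and reflections of interlacing partitions\<close>

section \<open>Interlacing partitions\<close>

text \<open>Padding with zeros makes comparisons row by row independent of the lengths.\<close>

definition pt :: "nat list \<Rightarrow> nat \<Rightarrow> nat" where
  "pt lam i = (if i < length lam then lam ! i else 0)"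

lemma cells_pt: "(i, j) \<in> cells lam \<longleftrightarrow> j < pt lam i"
  by (auto simp: cells_def pt_def)

lemma pt_antimono:
  assumes "is_partition lam" "i \<le> j"
  shows "pt lam j \<le> pt lam i"
  using assms by (cases "i = j") (auto simp: pt_def is_partition_def sorted_wrt_iff_nth_less)

lemma pt_eq_0_iff: "is_partition lam \<Longrightarrow> pt lam i = 0 \<longleftrightarrow> length lam \<le> i"
  unfolding pt_def is_partition_def by (metis nth_mem not_le)

lemma pt_eq_0: "length lam \<le> i \<Longrightarrow> pt lam i = 0"
  by (simp add: pt_def)

lemma pt_inject:
  assumes "is_partition lam" "is_partition mu" "\<And>i. pt lam i = pt mu i"
  shows "lam = mu"
proof -
  have len: "length lam = length mu"
    using assms pt_eq_0_iff by (metis le_antisym order_refl)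
  show ?thesis
  proof (rule nth_equalityI[OF len])
    fix i assume "i < length lam"
    then show "lam ! i = mu ! i"
      using assms(3)[of i] by (simp add: len pt_def)
  qed
qed

lemma sum_list_pt: "pt lam N = 0 \<Longrightarrow> is_partition lam \<Longrightarrow> sum_list lam = (\<Sum>i<N. pt lam i)"
proof -
  assume "pt lam N = 0" "is_partition lam"
  then have "length lam \<le> N" by (simp add: pt_eq_0_iff)
  have "sum_list lam = (\<Sum>i<length lam. pt lam i)"
    by (simp add: sum_list_sum_nth pt_def atLeast0LessThan)
  also have "\<dots> = (\<Sum>i<N. pt lam i)"
    using \<open>length lam \<le> N\<close> by (intro sum.mono_neutral_left) (auto simp: pt_def)
  finally show ?thesis .
qed

text \<open>Recovers a partition from its padded form by stopping before the first 0.\<close>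

definition part_of :: "(nat \<Rightarrow> nat) \<Rightarrow> nat list" where
  "part_of f = map f [0..<(LEAST n. f n = 0)]"

lemma
  assumes dec: "\<And>i. f (Suc i) \<le> f i" and zero: "f N = 0"
  shows is_partition_part_of: "is_partition (part_of f)"
    and pt_part_of: "pt (part_of f) i = f i"
proof -
  let ?n = "LEAST n. f n = 0"
  have n: "f ?n = 0" by (rule LeastI) (rule zero)
  have anti: "f j \<le> f i" if "i \<le> j" for i j
    using that by (induction rule: dec_induct) (auto intro: le_trans dec)
  have pos: "0 < f i" if "i < ?n" for i
    using not_less_Least[OF that] by simp
  show "is_partition (part_of f)"
    using pos by (fastforce simp: is_partition_def part_of_def sorted_wrt_map sorted_wrt_iff_nth_less anti)
  show "pt (part_of f) i = f i"
    using anti[of ?n i] n by (simp add: pt_def part_of_def)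
qed

text \<open>\<open>lam / mu\<close> is a horizontal strip.\<close>

definition hs :: "nat list \<Rightarrow> nat list \<Rightarrow> bool" where
  "hs mu lam \<longleftrightarrow> (\<forall>i. pt mu i \<le> pt lam i \<and> pt lam (Suc i) \<le> pt mu i)"

definition up :: "nat list \<Rightarrow> nat \<Rightarrow> nat list set" where
  "up mu k = {lam. is_partition lam \<and> hs mu lam \<and> sum_list lam = sum_list mu + k}"

definition down :: "nat list \<Rightarrow> nat \<Rightarrow> nat list set" where
  "down lam k = {mu. is_partition mu \<and> hs mu lam \<and> sum_list lam = sum_list mu + k}"

lemma finite_up [simp, intro]: "finite (up mu k)"
  by (rule finite_subset[OF _ finite_parts[of "sum_list mu + k"]]) (auto simp: up_def parts_def)

lemma finite_down [simp, intro]: "finite (down lam k)"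
  by (rule finite_subset[OF _ finite_parts[of "sum_list lam - k"]]) (auto simp: down_def parts_def)

text \<open>Used with interlacing bounds \<open>hi (Suc i) \<le> lo i\<close>: then every choice of
  values within the intervals is weakly decreasing.\<close>

definition box :: "(nat \<Rightarrow> nat) \<Rightarrow> (nat \<Rightarrow> nat) \<Rightarrow> nat list set" where
  "box lo hi = {mu. is_partition mu \<and> (\<forall>i. lo i \<le> pt mu i \<and> pt mu i \<le> hi i)}"

text \<open>Reflecting every part in its interval of admissible values is the Bender--Knuth involution;
  applied to the parts below the first one, it is a local step of the RSK correspondence.\<close>

definition toggle :: "(nat \<Rightarrow> nat) \<Rightarrow> (nat \<Rightarrow> nat) \<Rightarrow> nat list \<Rightarrow> nat list" where
  "toggle lo hi mu = part_of (\<lambda>i. lo i + hi i - pt mu i)"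

context
  fixes lo hi :: "nat \<Rightarrow> nat" and N :: nat and mu :: "nat list"
  assumes inter: "\<And>i. hi (Suc i) \<le> lo i" and zero: "hi N = 0" and mu: "mu \<in> box lo hi"
begin

lemma box_bounds: "lo i \<le> pt mu i" "pt mu i \<le> hi i"
  using mu by (auto simp: box_def)

lemma toggle_dec: "lo (Suc i) + hi (Suc i) - pt mu (Suc i) \<le> lo i + hi i - pt mu i"
  using box_bounds[of i] box_bounds[of "Suc i"] inter[of i] by linarith

lemma toggle_zero: "lo N + hi N - pt mu N = 0"
  using box_bounds[of N] zero by simp

lemma pt_toggle: "pt (toggle lo hi mu) i = lo i + hi i - pt mu i"
  unfolding toggle_def by (rule pt_part_of, rule toggle_dec, rule toggle_zero)

lemma is_partition_toggle: "is_partition (toggle lo hi mu)"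
  unfolding toggle_def by (rule is_partition_part_of, rule toggle_dec, rule toggle_zero)

lemma toggle_in_box: "toggle lo hi mu \<in> box lo hi"
proof -
  have "lo i \<le> pt (toggle lo hi mu) i \<and> pt (toggle lo hi mu) i \<le> hi i" for i
    unfolding pt_toggle using box_bounds[of i] by linarith
  then show ?thesis using is_partition_toggle by (simp add: box_def)
qed

text \<open>Inside the box the truncated subtraction is exact, and rows from \<open>N\<close> on are
  empty.\<close>

lemma sum_list_toggle: "sum_list (toggle lo hi mu) + sum_list mu = (\<Sum>i<N. lo i + hi i)"
proof -
  have "sum_list mu = (\<Sum>i<N. pt mu i)"
    using mu box_bounds[of N] zero by (intro sum_list_pt) (auto simp: box_def)
  moreover have "sum_list (toggle lo hi mu) = (\<Sum>i<N. lo i + hi i - pt mu i)"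
    using toggle_zero is_partition_toggle by (subst sum_list_pt[of _ N]) (auto simp: pt_toggle)
  moreover have "lo i + hi i - pt mu i + pt mu i = lo i + hi i" for i
    using box_bounds[of i] by simp
  ultimately show ?thesis by (simp add: sum.distrib[symmetric])
qed

end

lemma toggle_toggle:
  assumes "\<And>i. hi (Suc i) \<le> lo i" "hi N = 0" "mu \<in> box lo hi"
  shows "toggle lo hi (toggle lo hi mu) = mu"
proof (rule pt_inject)
  note box = toggle_in_box[of hi lo N mu, OF assms]
  show "is_partition (toggle lo hi (toggle lo hi mu))"
    by (rule is_partition_toggle[OF assms(1,2) box])
  show "is_partition mu" using assms by (simp add: box_def)
  show "pt (toggle lo hi (toggle lo hi mu)) i = pt mu i" for i
    using box_bounds[of hi lo N mu i, OF assms]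
    by (simp add: pt_toggle[OF assms(1,2) box] pt_toggle[OF assms])
qed

subsection \<open>Commutation of horizontal strips\<close>

text \<open>Two consecutive horizontal strips constrain each row of the middle partition separately.
  Row 0 has no row of \<open>kap\<close> above it, so its second upper bound just repeats
  \<open>pt lam 0\<close>.\<close>

lemma between_eq_box:
  "{mu. is_partition mu \<and> hs kap mu \<and> hs mu lam} =
    box (\<lambda>i. max (pt kap i) (pt lam (Suc i)))
        (\<lambda>i. min (pt lam i) (if i = 0 then pt lam 0 else pt kap (i - 1)))"
proof -
  have "(\<forall>i. pt mu (Suc i) \<le> pt kap i) \<longleftrightarrow>
      (\<forall>i. pt mu i \<le> (if i = 0 then pt lam 0 else pt kap (i - 1)))"
    if "pt mu 0 \<le> pt lam 0" for mu
  proof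
    assume L: "\<forall>i. pt mu (Suc i) \<le> pt kap i"
    show "\<forall>i. pt mu i \<le> (if i = 0 then pt lam 0 else pt kap (i - 1))"
    proof
      fix i show "pt mu i \<le> (if i = 0 then pt lam 0 else pt kap (i - 1))"
        using L that by (cases i) auto
    qed
  next
    assume R: "\<forall>i. pt mu i \<le> (if i = 0 then pt lam 0 else pt kap (i - 1))"
    show "\<forall>i. pt mu (Suc i) \<le> pt kap i"
      using R by (metis diff_Suc_1 nat.distinct(1))
  qed
  then show ?thesis
    unfolding box_def hs_def max.bounded_iff min.bounded_iff by blast
qed

text \<open>The max in row \<open>i\<close> and the min in row \<open>i + 1\<close> are taken over
  the same pair, so they add up to its sum; the min in row 0 is left over and equals
  \<open>g 0\<close>.\<close>

lemma sum_max_min_shift: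
  fixes f g :: "nat \<Rightarrow> nat"
  assumes "f N = 0" "g N = 0" "g (Suc N) = 0"
  shows "(\<Sum>i<Suc N. max (f i) (g (Suc i)) + min (g i) (if i = 0 then g 0 else f (i - 1))) =
    (\<Sum>i<Suc N. f i) + (\<Sum>i<Suc N. g i)"
proof -
  have "(\<Sum>i<Suc N. max (f i) (g (Suc i)) + min (g i) (if i = 0 then g 0 else f (i - 1))) =
      (\<Sum>i<Suc N. max (f i) (g (Suc i))) + (\<Sum>i<Suc N. min (g i) (if i = 0 then g 0 else f (i - 1)))"
    by (rule sum.distrib)
  also have "(\<Sum>i<Suc N. min (g i) (if i = 0 then g 0 else f (i - 1))) =
      g 0 + (\<Sum>i<N. min (g (Suc i)) (f i))"
    by (simp add: sum.lessThan_Suc_shift del: sum.lessThan_Suc)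
  also have "(\<Sum>i<Suc N. max (f i) (g (Suc i))) = (\<Sum>i<N. max (f i) (g (Suc i)))"
    using assms by simp
  also have "(\<Sum>i<N. max (f i) (g (Suc i))) + (g 0 + (\<Sum>i<N. min (g (Suc i)) (f i))) =
      g 0 + (\<Sum>i<N. max (f i) (g (Suc i)) + min (g (Suc i)) (f i))"
    by (simp add: sum.distrib)
  also have "\<dots> = g 0 + (\<Sum>i<N. f i + g (Suc i))"
    by (rule arg_cong[where f = "(+) (g 0)"], rule sum.cong) auto
  also have "\<dots> = (\<Sum>i<Suc N. f i) + (\<Sum>i<Suc N. g i)"
    using assms by (simp add: sum.distrib sum.lessThan_Suc_shift[of g] del: sum.lessThan_Suc)
       (simp add: sum.lessThan_Suc)
  finally show ?thesis .
qed

text \<open>Toggling the middle partition between fixed \<open>kap\<close> and \<open>lam\<close>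
  gives sizes that add up to those of \<open>kap\<close> and \<open>lam\<close>, hence exchanges the
  sizes \<open>a\<close> and \<open>b\<close> of the two strips.\<close>

lemma sum_down_down_commute:
  fixes g :: "nat list \<Rightarrow> 'a::comm_monoid_add"
  assumes lam: "is_partition lam"
  shows "(\<Sum>mu\<in>down lam a. \<Sum>kap\<in>down mu b. g kap) = (\<Sum>mu\<in>down lam b. \<Sum>kap\<in>down mu a. g kap)"
proof -
  define lo where "lo kap = (\<lambda>i. max (pt kap i) (pt lam (Suc i)))" for kap
  define hi where "hi kap = (\<lambda>i. min (pt lam i) (if i = 0 then pt lam 0 else pt kap (i - 1)))" for kap
  let ?t = "\<lambda>(mu, kap). (toggle (lo kap) (hi kap) mu, kap)"
  let ?S = "\<lambda>a b. SIGMA mu:down lam a. down mu b"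
  have inter: "hi kap (Suc i) \<le> lo kap i" for kap i
    by (simp add: hi_def lo_def)
  have box: "is_partition mu \<and> hs kap mu \<and> hs mu lam \<longleftrightarrow> mu \<in> box (lo kap) (hi kap)" for mu kap
    using between_eq_box[of kap lam] by (auto simp: lo_def hi_def)
  \<comment> \<open>Stated for arbitrary strip sizes, so that it serves both directions of the
    bijection.\<close>
  have pres: "(toggle (lo kap) (hi kap) mu, kap) \<in> ?S b a \<and>
      toggle (lo kap) (hi kap) (toggle (lo kap) (hi kap) mu) = mu"
    if mk: "(mu, kap) \<in> ?S a b" for mu kap a b
  proof -
    from mk have kap: "is_partition kap" and hs: "hs kap mu" "hs mu lam" "is_partition mu"
      and sums: "sum_list lam = sum_list mu + a" "sum_list mu = sum_list kap + b"
      by (auto simp: down_def)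
    define N where "N = length lam + length kap"
    have zeros: "pt kap N = 0" "pt lam N = 0" "pt lam (Suc N) = 0" "pt kap (Suc N) = 0"
      by (auto simp: N_def pt_def)
    then have hiN: "hi kap (Suc N) = 0" by (simp add: hi_def)
    have mu: "mu \<in> box (lo kap) (hi kap)" using hs box by blast
    have "sum_list (toggle (lo kap) (hi kap) mu) + sum_list mu = (\<Sum>i<Suc N. lo kap i + hi kap i)"
      by (rule sum_list_toggle[OF inter hiN mu])
    also have "\<dots> = (\<Sum>i<Suc N. pt kap i) + (\<Sum>i<Suc N. pt lam i)"
      unfolding lo_def hi_def using zeros by (intro sum_max_min_shift) auto
    also have "\<dots> = sum_list kap + sum_list lam"
      using zeros kap lam by (simp add: sum_list_pt[of _ "Suc N"] del: sum.lessThan_Suc)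
    finally have sum: "sum_list (toggle (lo kap) (hi kap) mu) + sum_list mu = sum_list kap + sum_list lam" .
    have "is_partition (toggle (lo kap) (hi kap) mu) \<and> hs kap (toggle (lo kap) (hi kap) mu) \<and>
        hs (toggle (lo kap) (hi kap) mu) lam"
      using toggle_in_box[of "hi kap" "lo kap", OF inter hiN mu] box by blast
    then show ?thesis
      using sums sum kap toggle_toggle[of "hi kap" "lo kap", OF inter hiN mu] by (auto simp: down_def)
  qed
  have "(\<Sum>mu\<in>down lam a. \<Sum>kap\<in>down mu b. g kap) = (\<Sum>(mu, kap)\<in>?S a b. g kap)"
    by (simp add: sum.Sigma)
  also have "\<dots> = (\<Sum>(mu, kap)\<in>?S b a. g kap)"
    using pres by (intro sum.reindex_bij_witness[of _ ?t ?t]) (auto simp del: mem_Sigma_iff)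
  also have "\<dots> = (\<Sum>mu\<in>down lam b. \<Sum>kap\<in>down mu a. g kap)"
    by (simp add: sum.Sigma)
  finally show ?thesis .
qed


section \<open>Exchange of adding and removing a strip\<close>

lemma pt_tl: "pt (tl lam) i = pt lam (Suc i)"
  by (cases lam) (auto simp: pt_def)

lemma is_partition_tl: "is_partition lam \<Longrightarrow> is_partition (tl lam)"
  by (cases lam) (auto simp: is_partition_def)

lemma sum_list_hd_tl: "sum_list lam = pt lam 0 + sum_list (tl lam)"
  by (cases lam) (auto simp: pt_def)

text \<open>The bounds of the next box combine the max of row \<open>i + 1\<close> with the min of
  row \<open>i\<close>; with the leftover max of row 0, each row contributes both.\<close>

lemma sum_max_min:
  fixes f g :: "nat \<Rightarrow> nat"
  assumes "f N = 0" "g N = 0"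
  shows "max (f 0) (g 0) + (\<Sum>i<N. max (f (Suc i)) (g (Suc i)) + min (f i) (g i)) =
    (\<Sum>i<Suc N. f i) + (\<Sum>i<Suc N. g i)"
proof -
  have "(\<Sum>i<Suc N. f i) + (\<Sum>i<Suc N. g i) = (\<Sum>i<Suc N. max (f i) (g i) + min (f i) (g i))"
    unfolding sum.distrib[symmetric] by (rule sum.cong) auto
  also have "\<dots> = (\<Sum>i<Suc N. max (f i) (g i)) + (\<Sum>i<N. min (f i) (g i))"
    using assms by (simp add: sum.distrib)
  also have "(\<Sum>i<Suc N. max (f i) (g i)) = max (f 0) (g 0) + (\<Sum>i<N. max (f (Suc i)) (g (Suc i)))"
    by (rule sum.lessThan_Suc_shift)
  finally show ?thesis by (simp add: sum.distrib)
qed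

text \<open>Fix \<open>nu\<close> and \<open>mu\<close>. For a partition above both, the rows below
  the first range over the same box as the rows of a partition \<open>kap\<close> below both, and
  the toggle matches them. Only the first row is free: its excess over the least possible value
  \<open>top mu\<close> is \<open>k\<close>.\<close>

lemma sum_up_down_commute:
  fixes g :: "nat list \<Rightarrow> 'a::comm_monoid_add"
  assumes nu: "is_partition nu"
  shows "(\<Sum>lam\<in>up nu b. \<Sum>mu\<in>down lam a. g mu) =
    (\<Sum>k\<le>min a b. \<Sum>kap\<in>down nu (a - k). \<Sum>mu\<in>up kap (b - k). g mu)"
proof -
  define lo where "lo mu = (\<lambda>i. max (pt nu (Suc i)) (pt mu (Suc i)))" for mu
  define hi where "hi mu = (\<lambda>i. min (pt nu i) (pt mu i))" for mu
  define top where "top mu = max (pt nu 0) (pt mu 0)" for mu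
  let ?t = "\<lambda>mu. toggle (lo mu) (hi mu)"
  let ?F = "\<lambda>(lam, mu). (pt lam 0 - top mu, ?t mu (tl lam), mu)"
  \<comment> \<open>The inverse map puts a first row of length \<open>top mu + k\<close> on top of
    the toggled rows of \<open>kap\<close>.\<close>
  let ?c = "\<lambda>k kap mu. part_of (case_nat (top mu + k) (pt (?t mu kap)))"
  let ?G = "\<lambda>(k, kap, mu). (?c k kap mu, mu)"
  let ?A = "SIGMA lam:up nu b. down lam a"
  let ?B = "SIGMA k:{..min a b}. SIGMA kap:down nu (a - k). up kap (b - k)"
  have inter: "hi mu (Suc i) \<le> lo mu i" for mu i
    by (simp add: hi_def lo_def)
  have below: "is_partition kap \<and> hs kap nu \<and> hs kap mu \<longleftrightarrow> kap \<in> box (lo mu) (hi mu)" for kap mu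
    by (auto simp: box_def hs_def lo_def hi_def)
  have above: "hs nu lam \<and> hs mu lam \<longleftrightarrow> top mu \<le> pt lam 0 \<and> tl lam \<in> box (lo mu) (hi mu)"
    if "is_partition lam" for lam mu
  proof -
    have shift: "(\<forall>i. pt x i \<le> pt lam i) \<longleftrightarrow> pt x 0 \<le> pt lam 0 \<and> (\<forall>i. pt x (Suc i) \<le> pt lam (Suc i))" for x
      by (metis not0_implies_Suc)
    show ?thesis
      unfolding box_def hs_def lo_def hi_def top_def all_conj_distrib shift
      using is_partition_tl[OF that] by (auto simp: pt_tl)
  qed
  have hiN: "hi mu (length nu + length mu) = 0" for mu
    by (simp add: hi_def pt_def)
  have sum_t: "top mu + (sum_list (?t mu kap) + sum_list kap) = sum_list nu + sum_list mu"
    if "kap \<in> box (lo mu) (hi mu)" "is_partition mu" for kap mu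
  proof -
    let ?N = "length nu + length mu"
    have "pt nu (Suc ?N) = 0" "pt mu (Suc ?N) = 0" "pt nu ?N = 0" "pt mu ?N = 0"
      by (simp_all add: pt_def)
    then show ?thesis
      unfolding sum_list_toggle[of "hi mu" "lo mu", OF inter hiN that(1)]
      using sum_max_min[of "pt nu" ?N "pt mu"] nu that(2)
      by (simp add: top_def lo_def hi_def sum_list_pt[of _ "Suc ?N"] del: sum.lessThan_Suc)
  qed
  have F: "?F (lam, mu) \<in> ?B \<and> ?G (?F (lam, mu)) = (lam, mu)" if lm: "(lam, mu) \<in> ?A" for lam mu
  proof -
    from lm have lam: "is_partition lam" and mu: "is_partition mu"
      and hs: "hs nu lam" "hs mu lam"
      and sums: "sum_list lam = sum_list nu + b" "sum_list lam = sum_list mu + a"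
      by (auto simp: up_def down_def)
    define kap where "kap = ?t mu (tl lam)"
    define k where "k = pt lam 0 - top mu"
    have top: "top mu \<le> pt lam 0" and tl: "tl lam \<in> box (lo mu) (hi mu)"
      using above[OF lam] hs by auto
    have kap: "kap \<in> box (lo mu) (hi mu)"
      unfolding kap_def by (rule toggle_in_box[OF inter hiN tl])
    have "sum_list lam + sum_list kap = sum_list nu + sum_list mu + k"
      using sum_t[OF tl mu] top sum_list_hd_tl[of lam] by (simp add: kap_def k_def)
    \<comment> \<open>These bounds yield \<open>k \<le> b\<close> and \<open>k \<le> a\<close>, so
      that \<open>b - k\<close> and \<open>a - k\<close> are exact.\<close>
    moreover have "sum_list kap \<le> sum_list mu" "sum_list kap \<le> sum_list nu"
    proof -
      have "pt kap i \<le> pt x i" if "x = mu \<or> x = nu" for x i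
        using below[of kap mu] kap that by (auto simp: hs_def)
      moreover have "is_partition kap" using kap by (simp add: box_def)
      ultimately show "sum_list kap \<le> sum_list mu" "sum_list kap \<le> sum_list nu"
        using mu nu
        by (auto simp: sum_list_pt[of _ "length mu + length nu + length kap"] pt_eq_0 intro!: sum_mono)
    qed
    ultimately have "(k, kap, mu) \<in> ?B"
      using sums mu below[of kap mu] kap by (auto simp: up_def down_def)
    moreover have "?c k kap mu = lam"
    proof (rule pt_inject)
      have tt: "?t mu kap = tl lam"
        unfolding kap_def by (rule toggle_toggle[OF inter hiN tl])
      have *: "case_nat (top mu + k) (pt (?t mu kap)) = pt lam"
        using top by (auto simp: fun_eq_iff tt pt_tl k_def split: nat.split)
      have **: "pt lam (Suc i) \<le> pt lam i" "pt lam (length lam) = 0" for i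
        using pt_antimono[OF lam, of i "Suc i"] by (auto simp: pt_eq_0)
      show "is_partition (?c k kap mu)" "pt (?c k kap mu) i = pt lam i" for i
        unfolding * using ** by (auto intro: is_partition_part_of pt_part_of)
    qed (rule lam)
    ultimately show ?thesis by (simp add: kap_def k_def)
  qed
  have G: "?G (k, kap, mu) \<in> ?A \<and> ?F (?G (k, kap, mu)) = (k, kap, mu)"
    if kkm: "(k, kap, mu) \<in> ?B" for k kap mu
  proof -
    from kkm have k: "k \<le> a" "k \<le> b" and kap: "kap \<in> box (lo mu) (hi mu)" and mu: "is_partition mu"
      and sums: "sum_list nu = sum_list kap + (a - k)" "sum_list mu = sum_list kap + (b - k)"
      using below[of kap mu] by (auto simp: up_def down_def)
    define lam where "lam = ?c k kap mu"
    note t = toggle_in_box[of "hi mu" "lo mu", OF inter hiN kap]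
    have dec: "case_nat (top mu + k) (pt (?t mu kap)) (Suc i) \<le> case_nat (top mu + k) (pt (?t mu kap)) i"
      and zero: "case_nat (top mu + k) (pt (?t mu kap)) (Suc (length (?t mu kap))) = 0" for i
    proof -
      have "is_partition (?t mu kap)" "pt (?t mu kap) 0 \<le> top mu"
        using t by (auto simp: box_def hi_def top_def intro: order_trans)
      then show "case_nat (top mu + k) (pt (?t mu kap)) (Suc i) \<le> case_nat (top mu + k) (pt (?t mu kap)) i"
        using pt_antimono[of "?t mu kap" "i - 1" i] by (auto split: nat.split)
      show "case_nat (top mu + k) (pt (?t mu kap)) (Suc (length (?t mu kap))) = 0"
        by (simp add: pt_eq_0)
    qed
    have lam: "is_partition lam" and pt_lam: "pt lam i = case_nat (top mu + k) (pt (?t mu kap)) i" for i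
      unfolding lam_def by (rule is_partition_part_of pt_part_of; rule dec zero)+
    have tl: "tl lam = ?t mu kap"
      using lam t by (intro pt_inject is_partition_tl) (auto simp: pt_tl pt_lam box_def)
    have "hs nu lam \<and> hs mu lam"
      using above[OF lam, of mu] t by (simp add: tl pt_lam)
    moreover have "sum_list lam + sum_list kap = sum_list nu + sum_list mu + k"
      using sum_t[OF kap mu] sum_list_hd_tl[of lam] by (simp add: tl pt_lam)
    ultimately have "(lam, mu) \<in> ?A"
      using lam mu sums k by (auto simp: up_def down_def)
    moreover have "?F (lam, mu) = (k, kap, mu)"
      using toggle_toggle[of "hi mu" "lo mu", OF inter hiN kap] by (simp add: tl pt_lam)
    ultimately show ?thesis by (simp add: lam_def)
  qed
  have "(\<Sum>lam\<in>up nu b. \<Sum>mu\<in>down lam a. g mu) = (\<Sum>(lam, mu)\<in>?A. g mu)"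
    by (simp add: sum.Sigma)
  also have "\<dots> = (\<Sum>(k, kap, mu)\<in>?B. g mu)"
  proof (rule sum.reindex_bij_witness[of _ ?G ?F])
    fix x assume "x \<in> ?A"
    then show "?G (?F x) = x" "?F x \<in> ?B" using F[of "fst x" "snd x"] by simp_all
    show "(case ?F x of (k, kap, mu) \<Rightarrow> g mu) = (case x of (lam, mu) \<Rightarrow> g mu)"
      by (simp split: prod.split)
  next
    fix y assume "y \<in> ?B"
    then show "?F (?G y) = y" "?G y \<in> ?A"
      using G[of "fst y" "fst (snd y)" "snd (snd y)"] by simp_all
  qed
  also have "\<dots> = (\<Sum>k\<le>min a b. \<Sum>kap\<in>down nu (a - k). \<Sum>mu\<in>up kap (b - k). g mu)"
    by (subst sum.Sigma[symmetric]; simp add: sum.Sigma)+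
  finally show ?thesis .
qed

section \<open>Tableaux: finiteness, homogeneity and the branching rule\<close>

section \<open>Schur functions\<close>

definition tabs :: "nat list \<Rightarrow> monom \<Rightarrow> (nat \<times> nat \<Rightarrow> nat) set" where
  "tabs lam m = {T. ssyt lam T \<and> tab_content lam T = m}"

lemma schur_tabs: "schur lam m = int (card (tabs lam m))"
  by (simp add: schur_def tabs_def)

lemma cells_Sigma: "cells lam = (SIGMA i:{..<length lam}. {..<pt lam i})"
  by (auto simp: cells_def pt_def)

lemma finite_cells [simp, intro]: "finite (cells lam)"
  by (simp add: cells_Sigma)

lemma card_cells: "card (cells lam) = sum_list lam"
proof -
  have "card (cells lam) = (\<Sum>i<length lam. pt lam i)"
    by (simp add: cells_Sigma)
  also have "\<dots> = sum_list lam"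
    by (simp add: sum_list_sum_nth pt_def atLeast0LessThan)
  finally show ?thesis .
qed

lemma lookup_tab_content: "Poly_Mapping.lookup (tab_content lam T) i = card {c \<in> cells lam. T c = i}"
proof -
  have "Poly_Mapping.lookup (tab_content lam T) i = (\<Sum>c\<in>cells lam. if T c = i then 1 else (0::nat))"
    by (simp add: tab_content_def lookup_sum lookup_single when_def del: One_nat_def)
  also have "\<dots> = card (cells lam \<inter> {c. T c = i})"
    by (simp add: sum.If_cases)
  finally show ?thesis by (simp add: Collect_conj_eq)
qed

lemma keys_tab_content: "Poly_Mapping.keys (tab_content lam T) = T ` cells lam"
  by (fastforce simp: in_keys_iff lookup_tab_content card_eq_0_iff)

lemma mdeg_tab_content: "mdeg (tab_content lam T) = sum_list lam"
  by (simp add: tab_content_def mdeg_sum card_cells)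

lemma finite_tabs [simp, intro]: "finite (tabs lam m)"
proof (rule finite_subset)
  show "tabs lam m \<subseteq> {T. \<forall>c. (c \<in> cells lam \<longrightarrow> T c \<in> Poly_Mapping.keys m) \<and> (c \<notin> cells lam \<longrightarrow> T c = 0)}"
    by (auto simp: tabs_def keys_tab_content ssyt_def)
  show "finite {T. \<forall>c. (c \<in> cells lam \<longrightarrow> T c \<in> Poly_Mapping.keys m) \<and> (c \<notin> cells lam \<longrightarrow> T c = 0)}"
    by (intro finite_set_of_finite_funs) auto
qed

lemma homog_schur: "homog (sum_list lam) (schur lam)"
proof -
  have "tabs lam m = {}" if "mdeg m \<noteq> sum_list lam" for m
    using that mdeg_tab_content by (auto simp: tabs_def)
  then show ?thesis by (auto simp: homog_def schur_tabs)
qed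

lemma schur_Nil: "schur [] = mone"
proof
  fix m
  have "tabs [] m = (if m = 0 then {\<lambda>_. 0} else {})"
    by (auto simp: tabs_def ssyt_def tab_content_def cells_def)
  then show "schur [] m = mone m" by (simp add: schur_tabs mone_def)
qed

lemma schur_0: "is_partition lam \<Longrightarrow> schur lam 0 = (if lam = [] then 1 else 0)"
proof (cases "lam = []")
  case False
  assume "is_partition lam"
  with False have "sum_list lam \<noteq> 0" by (cases lam) (auto simp: is_partition_def)
  then show ?thesis using False homogD[OF homog_schur, of 0 lam] by simp
qed (simp add: schur_Nil mone_def)

lemma ssyt_row_mono:
  assumes "ssyt lam T" "(i, k) \<in> cells lam" "j \<le> k"
  shows "T (i, j) \<le> T (i, k)"
  using assms(3,2)
proof (induction k rule: dec_induct)
  case (step n)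
  then have "T (i, j) \<le> T (i, n)" by (simp add: cells_pt)
  also have "\<dots> \<le> T (i, Suc n)"
    using step.prems assms(1) by (simp add: ssyt_def)
  finally show ?case .
qed simp

lemma tab_content_split:
  assumes "cells mu \<subseteq> cells lam" "\<And>c. c \<in> cells mu \<Longrightarrow> T' c = T c"
    and "\<And>c. c \<in> cells lam - cells mu \<Longrightarrow> T c = N"
  shows "tab_content lam T = tab_content mu T' + Poly_Mapping.single N (sum_list lam - sum_list mu)"
proof -
  have single: "(\<Sum>c\<in>A. Poly_Mapping.single N (1::nat)) = Poly_Mapping.single N (card A)" if "finite A" for A
    using that by (induction A rule: finite_induct) (auto simp: single_add[symmetric] simp del: sum_constant)
  have "tab_content lam T =
      (\<Sum>c\<in>cells mu. Poly_Mapping.single (T c) 1) + (\<Sum>c\<in>cells lam - cells mu. Poly_Mapping.single (T c) 1)"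
    unfolding tab_content_def using assms(1) by (simp add: sum.subset_diff add.commute)
  also have "(\<Sum>c\<in>cells lam - cells mu. Poly_Mapping.single (T c) (1::nat)) =
      (\<Sum>c\<in>cells lam - cells mu. Poly_Mapping.single N 1)"
    using assms(3) by (intro sum.cong) auto
  also have "\<dots> = Poly_Mapping.single N (sum_list lam - sum_list mu)"
    using assms(1) single[of "cells lam - cells mu"]
    by (simp add: card_Diff_subset card_cells del: sum_constant)
  also have "(\<Sum>c\<in>cells mu. Poly_Mapping.single (T c) (1::nat)) = tab_content mu T'"
    unfolding tab_content_def using assms(2) by (intro sum.cong) auto
  finally show ?thesis .
qed

lemma hs_cells_subset: "hs mu lam \<Longrightarrow> cells mu \<subseteq> cells lam"
  by (auto simp: cells_pt hs_def) (meson less_le_trans)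

lemma sum_list_le_hs: "hs mu lam \<Longrightarrow> sum_list mu \<le> sum_list lam"
  unfolding card_cells[symmetric] by (intro card_mono hs_cells_subset) auto

lemma monom_split_last_unique:
  fixes m m' :: monom
  assumes "Poly_Mapping.keys m \<subseteq> {..<N}" "Poly_Mapping.keys m' \<subseteq> {..<N}"
    and "m + Poly_Mapping.single N k = m' + Poly_Mapping.single N k'"
  shows "m = m' \<and> k = k'"
proof -
  have "Poly_Mapping.lookup m N = 0" "Poly_Mapping.lookup m' N = 0"
    using assms by (auto simp: in_keys_iff)
  then have "k = k'"
    using arg_cong[OF assms(3), of "\<lambda>x. Poly_Mapping.lookup x N"] by (simp add: lookup_add)
  then show ?thesis using assms(3) by simp
qed

text \<open>In a tableau with entries up to \<open>N\<close>, those equal to \<open>N\<close> fill a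
  horizontal strip, because columns are strict; the smaller entries form a tableau of the remaining
  shape \<open>mu\<close>.\<close>

lemma schur_branch:
  assumes lam: "is_partition lam" and keys: "Poly_Mapping.keys m \<subseteq> {..<N}"
  shows "schur lam (m + Poly_Mapping.single N k) = (\<Sum>mu\<in>down lam k. schur mu m)"
proof -
  define G where "G = (\<lambda>(mu, T) c. if c \<in> cells mu then T c else if c \<in> cells lam then N else (0::nat))"
  let ?S = "SIGMA mu:down lam k. tabs mu m"
  have small: "T c < N" if "T \<in> tabs mu m" "c \<in> cells mu" for T mu c
    using that keys by (fastforce simp: tabs_def keys_tab_content)
  \<comment> \<open>The shape \<open>mu\<close> can be read off the image as the set of cells with
    entries below \<open>N\<close>, which gives injectivity.\<close>
  have shape: "{c \<in> cells lam. G (mu, T) c < N} = cells mu" if "(mu, T) \<in> ?S" for mu T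
    using that small[of T mu] hs_cells_subset[of mu lam] by (auto simp: G_def down_def)
  have G_in: "G x \<in> tabs lam (m + Poly_Mapping.single N k)" if x: "x \<in> ?S" for x
  proof -
    obtain mu T where [simp]: "x = (mu, T)" by (cases x)
    have mu: "is_partition mu" "hs mu lam" "sum_list lam = sum_list mu + k"
      and T: "ssyt mu T" "tab_content mu T = m" "T \<in> tabs mu m"
      using x by (auto simp: down_def tabs_def)
    have sub: "cells mu \<subseteq> cells lam" using mu by (intro hs_cells_subset)
    have "tab_content lam (G x) = m + Poly_Mapping.single N k"
      using mu T tab_content_split[of mu lam T "G x" N] sub by (auto simp: G_def)
    moreover have "ssyt lam (G x)"
      unfolding ssyt_def
    proof (intro conjI allI impI)
      fix c assume "c \<notin> cells lam" then show "G x c = 0" using sub by (auto simp: G_def)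
    next
      fix i j assume c: "(i, Suc j) \<in> cells lam"
      show "G x (i, j) \<le> G x (i, Suc j)"
      proof (cases "(i, Suc j) \<in> cells mu")
        case True
        then have "(i, j) \<in> cells mu" by (simp add: cells_pt)
        then show ?thesis using True T(1) by (simp add: G_def ssyt_def)
      next
        case False
        then show ?thesis using c small[OF T(3), of "(i, j)"] by (auto simp: G_def)
      qed
    next
      fix i j assume c: "(Suc i, j) \<in> cells lam"
      then have "(i, j) \<in> cells mu"
        using mu(2) by (auto simp: cells_pt hs_def intro: less_le_trans)
      then show "G x (i, j) < G x (Suc i, j)"
        using c T(1) small[OF T(3), of "(i, j)"] by (auto simp: G_def ssyt_def)
    qed
    ultimately show ?thesis by (simp add: tabs_def)
  qed
  have "inj_on G ?S"
  proof (rule inj_onI)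
    fix x y assume x: "x \<in> ?S" and y: "y \<in> ?S" and eq: "G x = G y"
    obtain mu T where [simp]: "x = (mu, T)" by (cases x)
    obtain mu' T' where [simp]: "y = (mu', T')" by (cases y)
    have cells_eq: "cells mu = cells mu'"
      using shape[of mu T] shape[of mu' T'] x y eq by simp
    have "pt mu i = pt mu' i" for i
    proof -
      have "{j. j < pt mu i} = {j. j < pt mu' i}"
        using cells_eq unfolding cells_pt[symmetric] by simp
      then show ?thesis by (metis card_Collect_less_nat)
    qed
    then have "mu = mu'"
      using x y by (intro pt_inject) (auto simp: down_def)
    moreover have "T c = T' c" for c
    proof (cases "c \<in> cells mu")
      case True
      then show ?thesis using fun_cong[OF eq, of c] cells_eq by (simp add: G_def)
    next
      case False
      have "ssyt mu T" "ssyt mu' T'" using x y by (auto simp: tabs_def)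
      then show ?thesis using False cells_eq by (cases c) (simp add: ssyt_def)
    qed
    ultimately show "x = y" by auto
  qed
  moreover have "tabs lam (m + Poly_Mapping.single N k) \<subseteq> G ` ?S"
  proof
    fix T assume "T \<in> tabs lam (m + Poly_Mapping.single N k)"
    then have T: "ssyt lam T" and cont: "tab_content lam T = m + Poly_Mapping.single N k"
      by (auto simp: tabs_def)
    have le: "T c \<le> N" if "c \<in> cells lam" for c
    proof -
      have "T c \<in> Poly_Mapping.keys (m + Poly_Mapping.single N k)"
        using that by (simp add: cont[symmetric] keys_tab_content)
      then have "T c \<in> Poly_Mapping.keys m \<union> Poly_Mapping.keys (Poly_Mapping.single N k)"
        by (rule subsetD[OF keys_add])
      then show ?thesis using keys by (auto split: if_splits)
    qed
    \<comment> \<open>\<open>f i\<close> is the length of the initial run of entries below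
      \<open>N\<close> in row \<open>i\<close>. Rows increase weakly, so the run contains all such
      entries.\<close>
    define f where "f i = (LEAST j. \<not> ((i, j) \<in> cells lam \<and> T (i, j) < N))" for i
    have not_f: "\<not> ((i, f i) \<in> cells lam \<and> T (i, f i) < N)" for i
      unfolding f_def by (rule LeastI[of _ "pt lam i"]) (simp add: cells_pt)
    have f: "j < f i \<longleftrightarrow> (i, j) \<in> cells lam \<and> T (i, j) < N" for i j
    proof
      assume "j < f i" then show "(i, j) \<in> cells lam \<and> T (i, j) < N"
        using not_less_Least[of j "\<lambda>j. \<not> ((i, j) \<in> cells lam \<and> T (i, j) < N)"]
        unfolding f_def by simp
    next
      assume j: "(i, j) \<in> cells lam \<and> T (i, j) < N"
      show "j < f i"
      proof (rule ccontr)
        assume "\<not> j < f i"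
        then have "T (i, f i) \<le> T (i, j)" "(i, f i) \<in> cells lam"
          using j ssyt_row_mono[OF T, of i j "f i"] by (auto simp: cells_pt)
        then show False using not_f[of i] j by simp
      qed
    qed
    have up: "(i, j) \<in> cells lam \<and> T (i, j) < T (Suc i, j)" if "(Suc i, j) \<in> cells lam" for i j
      using that T pt_antimono[OF lam, of i "Suc i"] by (auto simp: cells_pt ssyt_def)
    have dec: "f (Suc i) \<le> f i" for i
    proof (rule ccontr)
      assume "\<not> f (Suc i) \<le> f i"
      then have "f i < f (Suc i)" by simp
      then have "f i < f i" unfolding f using up[of i "f i"] by auto
      then show False by simp
    qed
    have f_le: "f i \<le> pt lam i" for i
      using f[of "pt lam i" i] by (auto simp: cells_pt)
    \<comment> \<open>A cell of row \<open>i + 1\<close> in column \<open>f i\<close> has an entry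
      of at most \<open>N\<close>, which would force an entry below \<open>N\<close> just above
      it.\<close>
    have le_f: "pt lam (Suc i) \<le> f i" for i
    proof (rule ccontr)
      assume "\<not> pt lam (Suc i) \<le> f i"
      then have c: "(Suc i, f i) \<in> cells lam" by (simp add: cells_pt)
      then show False using up[OF c] le[OF c] not_f[of i] by simp
    qed
    define mu where "mu = part_of f"
    have zero: "f (length lam) = 0" using f_le[of "length lam"] by (simp add: pt_eq_0)
    have mu: "is_partition mu" and pt_mu: "pt mu i = f i" for i
      unfolding mu_def by (rule is_partition_part_of pt_part_of; rule dec zero)+
    have hs: "hs mu lam" using f_le le_f by (simp add: hs_def pt_mu)
    have cells_mu: "c \<in> cells mu \<longleftrightarrow> c \<in> cells lam \<and> T c < N" for c
      by (cases c) (simp add: cells_pt[of _ _ mu] pt_mu f)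
    define T' where "T' c = (if c \<in> cells mu then T c else 0)" for c
    have "tab_content lam T = tab_content mu T' + Poly_Mapping.single N (sum_list lam - sum_list mu)"
      using le by (intro tab_content_split) (auto simp: T'_def cells_mu intro: le_antisym)
    then have "m + Poly_Mapping.single N k = tab_content mu T' + Poly_Mapping.single N (sum_list lam - sum_list mu)"
      by (simp add: cont)
    then have "m = tab_content mu T' \<and> k = sum_list lam - sum_list mu"
      using keys by (intro monom_split_last_unique[of _ N]) (auto simp: keys_tab_content T'_def cells_mu)
    moreover have "ssyt mu T'"
      unfolding ssyt_def
    proof (intro conjI allI impI)
      fix c assume "c \<notin> cells mu" then show "T' c = 0" by (simp add: T'_def)
    next
      fix i j assume c: "(i, Suc j) \<in> cells mu"
      then have "(i, j) \<in> cells mu" by (simp add: cells_pt)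
      moreover have "T (i, j) \<le> T (i, Suc j)"
        using T c cells_mu[of "(i, Suc j)"] by (simp add: ssyt_def)
      ultimately show "T' (i, j) \<le> T' (i, Suc j)" using c by (simp add: T'_def)
    next
      fix i j assume c: "(Suc i, j) \<in> cells mu"
      then have "(i, j) \<in> cells mu" using pt_antimono[OF mu, of i "Suc i"] by (simp add: cells_pt)
      moreover have "T (i, j) < T (Suc i, j)"
        using T c cells_mu[of "(Suc i, j)"] by (simp add: ssyt_def)
      ultimately show "T' (i, j) < T' (Suc i, j)" using c by (simp add: T'_def)
    qed
    ultimately have "(mu, T') \<in> ?S"
      using mu hs sum_list_le_hs[OF hs] by (auto simp: down_def tabs_def)
    moreover have "T = G (mu, T')"
      using T le by (auto simp: fun_eq_iff G_def T'_def cells_mu ssyt_def intro: le_antisym)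
    ultimately show "T \<in> G ` ?S" by blast
  qed
  then have "G ` ?S = tabs lam (m + Poly_Mapping.single N k)"
    using G_in by blast
  ultimately have "card (tabs lam (m + Poly_Mapping.single N k)) = card ?S"
    by (metis card_image)
  then show ?thesis by (simp add: schur_tabs)
qed

section \<open>Unitriangularity of the Kostka matrix\<close>

subsection \<open>Unitriangularity\<close>

definition pmon :: "nat list \<Rightarrow> monom" where
  "pmon al = (\<Sum>i<length al. Poly_Mapping.single i (pt al i))"

lemma lookup_pmon: "Poly_Mapping.lookup (pmon al) i = pt al i"
  by (simp add: pmon_def lookup_sum lookup_single when_def pt_eq_0)

lemma mdeg_pmon: "mdeg (pmon al) = sum_list al"
  by (simp add: pmon_def mdeg_sum sum_list_sum_nth pt_def atLeast0LessThan)

lemma pmon_inject: "is_partition lam \<Longrightarrow> is_partition mu \<Longrightarrow> pmon lam = pmon mu \<Longrightarrow> lam = mu"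
  by (rule pt_inject) (auto simp: lookup_pmon[symmetric])

text \<open>A numerical rank in place of the dominance order; at the content of a tableau it is the
  sum of the entries.\<close>

definition wt :: "monom \<Rightarrow> nat" where
  "wt m = (\<Sum>i\<in>Poly_Mapping.keys m. i * Poly_Mapping.lookup m i)"

lemma wt_add: "wt (a + b) = wt a + wt b"
  unfolding wt_def by (rule setsum_keys_plus_distrib) (auto simp: distrib_left)

lemma wt_tab_content: "wt (tab_content lam T) = (\<Sum>c\<in>cells lam. T c)"
proof -
  have "wt (\<Sum>c\<in>A. Poly_Mapping.single (T c) 1) = (\<Sum>c\<in>A. T c)" if "finite A" for A
    using that by (induction A rule: finite_induct) (simp_all add: wt_add, simp_all add: wt_def)
  then show ?thesis by (simp add: tab_content_def)
qed

lemma ssyt_ge_row: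
  assumes "is_partition lam" "ssyt lam T"
  shows "(i, j) \<in> cells lam \<Longrightarrow> i \<le> T (i, j)"
proof (induction i)
  case (Suc i)
  then have "i \<le> T (i, j)" using pt_antimono[OF assms(1), of i "Suc i"] by (simp add: cells_pt)
  also have "\<dots> < T (Suc i, j)" using Suc.prems assms(2) by (simp add: ssyt_def)
  finally show ?case by simp
qed simp

definition row_tab :: "nat list \<Rightarrow> nat \<times> nat \<Rightarrow> nat" where
  "row_tab lam c = (if c \<in> cells lam then fst c else 0)"

lemma ssyt_row_tab: "is_partition lam \<Longrightarrow> ssyt lam (row_tab lam)"
  using pt_antimono[of lam] by (auto simp: ssyt_def row_tab_def cells_pt)

lemma tab_content_row_tab: "tab_content lam (row_tab lam) = pmon lam"
proof (rule poly_mapping_eqI)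
  fix i
  have "{c \<in> cells lam. row_tab lam c = i} = Pair i ` {..<pt lam i}"
    by (auto simp: row_tab_def cells_pt)
  then show "Poly_Mapping.lookup (tab_content lam (row_tab lam)) i = Poly_Mapping.lookup (pmon lam) i"
    by (simp add: lookup_tab_content lookup_pmon card_image inj_on_def)
qed

text \<open>A tableau has entries at least \<open>i\<close> in row \<open>i\<close>, so the sum of its entries is minimal exactly
  for the tableau whose row \<open>i\<close> is constantly \<open>i\<close>.\<close>

lemma ssyt_wt:
  assumes lam: "is_partition lam" and T: "ssyt lam T"
  shows "wt (pmon lam) < wt (tab_content lam T) \<or> T = row_tab lam"
proof (cases "T = row_tab lam")
  case False
  then obtain c where c: "T c \<noteq> row_tab lam c" by blast
  with T have "c \<in> cells lam" unfolding ssyt_def row_tab_def by presburger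
  moreover have ge: "row_tab lam c \<le> T c" if "c \<in> cells lam" for c
    using ssyt_ge_row[OF lam T, of "fst c" "snd c"] that by (simp add: row_tab_def)
  ultimately have "row_tab lam c < T c" using c by (simp add: le_neq_implies_less)
  then have "(\<Sum>c\<in>cells lam. row_tab lam c) < (\<Sum>c\<in>cells lam. T c)"
    using ge \<open>c \<in> cells lam\<close> by (intro sum_strict_mono_ex1) auto
  then show ?thesis by (simp add: wt_tab_content tab_content_row_tab[symmetric])
qed simp

lemma schur_pmon_triangular:
  assumes "is_partition lam" "is_partition al" "schur lam (pmon al) \<noteq> 0"
  shows "wt (pmon lam) < wt (pmon al) \<or> lam = al"
proof -
  from assms(3) obtain T where "T \<in> tabs lam (pmon al)"
    by (metis card.empty ex_in_conv of_nat_0 schur_tabs)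
  then have "ssyt lam T" "tab_content lam T = pmon al" by (auto simp: tabs_def)
  then show ?thesis
    using ssyt_wt[OF assms(1), of T] pmon_inject[OF assms(1,2)] tab_content_row_tab by metis
qed

lemma schur_pmon_self:
  assumes "is_partition lam"
  shows "schur lam (pmon lam) = 1"
proof -
  have "tabs lam (pmon lam) = {row_tab lam}"
    using ssyt_wt[OF assms] ssyt_row_tab[OF assms] tab_content_row_tab
    by (auto simp: tabs_def) (metis less_irrefl)+
  then show ?thesis by (simp add: schur_tabs)
qed

section \<open>Symmetry of Schur functions, and reduction of symmetric series to partition
  exponents\<close>

subsection \<open>Symmetry\<close>

text \<open>Kostka numbers; the content is a list of multiplicities, that of the largest entry first.\<close>

fun kos :: "nat list \<Rightarrow> nat list \<Rightarrow> int" where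
  "kos [] lam = (if lam = [] then 1 else 0)"
| "kos (a # as) lam = (\<Sum>mu\<in>down lam a. kos as mu)"

text \<open>Iterated branching; the list is reversed because the largest variable is removed
  first.\<close>

lemma schur_kos:
  assumes "Poly_Mapping.keys m \<subseteq> {..<N}" "is_partition lam"
  shows "schur lam m = kos (map (Poly_Mapping.lookup m) (rev [0..<N])) lam"
  using assms
proof (induction N m arbitrary: lam rule: monom_bounded_induct)
  case zero
  then show ?case by (simp add: schur_0)
next
  case (step N m k)
  have "Poly_Mapping.lookup m N = 0" using step.hyps by (auto simp: in_keys_iff)
  moreover have "map (Poly_Mapping.lookup (m + Poly_Mapping.single N k)) (rev [0..<N]) =
      map (Poly_Mapping.lookup m) (rev [0..<N])"
    by (auto simp: lookup_add lookup_single)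
  ultimately have "map (Poly_Mapping.lookup (m + Poly_Mapping.single N k)) (rev [0..<Suc N]) =
      k # map (Poly_Mapping.lookup m) (rev [0..<N])"
    by (simp add: lookup_add)
  then show ?case
    using step by (simp add: schur_branch del: map_eq_conv upt_Suc) (auto simp: down_def intro!: sum.cong)
qed

lemma kos_swap: "is_partition lam \<Longrightarrow> kos (a # b # as) lam = kos (b # a # as) lam"
  by (simp add: sum_down_down_commute)

text \<open>Insertion sort uses adjacent swaps only, and each is an instance of
  \<open>kos_swap\<close>.\<close>

lemma kos_insort: "is_partition lam \<Longrightarrow> kos (insort x xs) lam = kos (x # xs) lam"
proof (induction xs arbitrary: lam)
  case (Cons y ys)
  show ?case
  proof (cases "x \<le> y")
    case False
    have "kos (insort x (y # ys)) lam = (\<Sum>mu\<in>down lam y. kos (insort x ys) mu)"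
      using False by simp
    also have "\<dots> = (\<Sum>mu\<in>down lam y. kos (x # ys) mu)"
      by (rule sum.cong[OF refl], rule Cons.IH) (simp add: down_def)
    also have "\<dots> = kos (y # x # ys) lam" by simp
    also have "\<dots> = kos (x # y # ys) lam" by (rule kos_swap) fact
    finally show ?thesis .
  qed simp
qed simp

lemma kos_sort: "is_partition lam \<Longrightarrow> kos (sort xs) lam = kos xs lam"
proof (induction xs arbitrary: lam)
  case (Cons x xs)
  have "kos (sort (x # xs)) lam = kos (x # sort xs) lam"
    using Cons.prems by (simp add: kos_insort del: kos.simps)
  also have "\<dots> = kos (x # xs) lam"
    by (simp, rule sum.cong[OF refl], rule Cons.IH) (simp add: down_def)
  finally show ?case .
qed simp

lemma kos_cong_mset: "is_partition lam \<Longrightarrow> mset xs = mset ys \<Longrightarrow> kos xs lam = kos ys lam"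
  by (metis kos_sort sorted_list_of_multiset_mset)

text \<open>Only permutations of finitely many variables are considered, with \<open>N\<close>
  bounding both the permutation and the support; \<open>map_key p\<close> composes the exponent
  vector with \<open>p\<close>.\<close>

definition symm :: "mfps \<Rightarrow> bool" where
  "symm f \<longleftrightarrow> (\<forall>N p m. p permutes {..<N} \<longrightarrow> Poly_Mapping.keys m \<subseteq> {..<N} \<longrightarrow>
     f (Poly_Mapping.map_key p m) = f m)"

lemma lookup_map_key: "inj p \<Longrightarrow> Poly_Mapping.lookup (Poly_Mapping.map_key p m) i = Poly_Mapping.lookup m (p i)"
  by (simp add: map_key.rep_eq)

lemma keys_map_key_permutes:
  assumes "p permutes {..<N}" "Poly_Mapping.keys m \<subseteq> {..<N}"
  shows "Poly_Mapping.keys (Poly_Mapping.map_key p m) \<subseteq> {..<N}"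
proof
  fix i assume "i \<in> Poly_Mapping.keys (Poly_Mapping.map_key p m)"
  then have "p i \<in> {..<N}"
    using assms by (auto simp: in_keys_iff lookup_map_key permutes_inj)
  then show "i \<in> {..<N}" using permutes_in_image[OF assms(1)] by blast
qed

lemma symm_schur:
  assumes "is_partition lam"
  shows "symm (schur lam)"
  unfolding symm_def
proof (intro allI impI)
  fix N :: nat and p and m :: monom
  assume p: "p permutes {..<N}" and m: "Poly_Mapping.keys m \<subseteq> {..<N}"
  have look: "Poly_Mapping.lookup (Poly_Mapping.map_key p m) = Poly_Mapping.lookup m \<circ> p"
    using permutes_inj[OF p] by (simp add: fun_eq_iff lookup_map_key)
  have "mset (map (Poly_Mapping.lookup (Poly_Mapping.map_key p m)) (rev [0..<N])) =
      image_mset (Poly_Mapping.lookup m) (image_mset p (mset_set {..<N}))"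
    by (simp add: look multiset.map_comp atLeast0LessThan)
  also have "image_mset p (mset_set {..<N}) = mset_set (p ` {..<N})"
    by (rule image_mset_mset_set) (rule permutes_inj_on[OF p])
  also have "image_mset (Poly_Mapping.lookup m) (mset_set (p ` {..<N})) =
      mset (map (Poly_Mapping.lookup m) (rev [0..<N]))"
    by (simp add: permutes_image[OF p] atLeast0LessThan)
  finally show "schur lam (Poly_Mapping.map_key p m) = schur lam m"
    unfolding schur_kos[OF m assms] schur_kos[OF keys_map_key_permutes[OF p m] assms]
    by (rule kos_cong_mset[OF assms])
qed

lemma symm_mone: "symm mone"
  unfolding symm_def
proof (intro allI impI)
  fix N :: nat and p and m :: monom
  assume p: "p permutes {..<N}"
  have "(Poly_Mapping.map_key p m :: monom) = 0 \<longleftrightarrow> m = 0"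
  proof
    assume 0: "Poly_Mapping.map_key p m = 0"
    have "Poly_Mapping.lookup m i = 0" for i
    proof -
      have "Poly_Mapping.lookup m (p (inv_into UNIV p i)) = 0"
        using 0 permutes_inj[OF p] by (metis lookup_map_key lookup_zero)
      then show ?thesis by (simp add: permutes_inverses[OF p])
    qed
    then show "m = 0" by (auto intro: poly_mapping_eqI)
  next
    assume "m = 0"
    then show "Poly_Mapping.map_key p m = 0"
      using permutes_inj[OF p] by (auto intro!: poly_mapping_eqI simp: lookup_map_key)
  qed
  then show "mone (Poly_Mapping.map_key p m) = mone m" by (simp add: mone_def)
qed

text \<open>Renaming by \<open>p\<close> is a bijection from the factorisations of \<open>m\<close>
  to those of the renamed monomial.\<close>

lemma symm_mmult:
  assumes "symm f" "symm g"
  shows "symm (mmult f g)"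
  unfolding symm_def
proof (intro allI impI)
  fix N :: nat and p and m :: monom
  assume p: "p permutes {..<N}" and m: "Poly_Mapping.keys m \<subseteq> {..<N}"
  have q: "inv_into UNIV p permutes {..<N}" by (rule permutes_inv[OF p])
  note inj = permutes_inj[OF p] permutes_inj[OF q]
  let ?k = "\<lambda>p. map_prod (Poly_Mapping.map_key p) (Poly_Mapping.map_key p)"
  have add: "Poly_Mapping.map_key p' (a + b) = Poly_Mapping.map_key p' a + Poly_Mapping.map_key p' b"
    if "inj p'" for p' and a b :: monom
    using that by (auto intro!: poly_mapping_eqI simp: lookup_map_key lookup_add)
  have inv1: "Poly_Mapping.map_key p (Poly_Mapping.map_key (inv_into UNIV p) a) = a"
    and inv2: "Poly_Mapping.map_key (inv_into UNIV p) (Poly_Mapping.map_key p a) = a" for a :: monom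
    using inj by (auto intro!: poly_mapping_eqI simp: lookup_map_key permutes_inverses[OF p])
  have "(\<Sum>(a, b)\<in>splits m. f a * g b) = (\<Sum>(a, b)\<in>splits (Poly_Mapping.map_key p m). f a * g b)"
  proof (rule sum.reindex_bij_witness[of _ "?k (inv_into UNIV p)" "?k p"])
    fix x assume x: "x \<in> splits m"
    obtain a b where [simp]: "x = (a, b)" by (cases x)
    have "Poly_Mapping.keys a \<subseteq> {..<N}" "Poly_Mapping.keys b \<subseteq> {..<N}"
      using x m by (auto simp: in_keys_iff lookup_add subset_iff)
    then have "f (Poly_Mapping.map_key p a) = f a" "g (Poly_Mapping.map_key p b) = g b"
      using assms p by (auto simp: symm_def)
    then show "(case ?k p x of (a, b) \<Rightarrow> f a * g b) = (case x of (a, b) \<Rightarrow> f a * g b)" by simp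
    show "?k (inv_into UNIV p) (?k p x) = x" by (simp add: inv2)
    show "?k p x \<in> splits (Poly_Mapping.map_key p m)" using x inj by (auto simp: add)
  next
    fix y assume y: "y \<in> splits (Poly_Mapping.map_key p m)"
    show "?k p (?k (inv_into UNIV p) y) = y" by (cases y) (simp add: inv1)
    have "Poly_Mapping.map_key (inv_into UNIV p) (fst y) + Poly_Mapping.map_key (inv_into UNIV p) (snd y) =
        Poly_Mapping.map_key (inv_into UNIV p) (Poly_Mapping.map_key p m)"
      using y inj by (cases y) (simp add: add[symmetric])
    then show "?k (inv_into UNIV p) y \<in> splits m" by (cases y) (simp add: inv2)
  qed
  then show "mmult f g (Poly_Mapping.map_key p m) = mmult f g m" by (simp add: mmult_splits)
qed

lemma symm_mprod_list: "(\<And>f. f \<in> set fs \<Longrightarrow> symm f) \<Longrightarrow> symm (mprod_list fs)"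
  by (induction fs) (auto intro: symm_mone symm_mmult)

text \<open>The exponents are sorted decreasingly. As \<open>al\<close> is chosen before
  \<open>f\<close>, it serves a series and all Schur functions at once.\<close>

lemma symm_eq_at_partition:
  "\<exists>al\<in>parts (mdeg m). \<forall>f. symm f \<longrightarrow> f m = f (pmon al)"
proof -
  obtain N where m: "Poly_Mapping.keys m \<subseteq> {..<N}" using keys_subset_lessThan_ex by blast
  define xs where "xs = map (Poly_Mapping.lookup m) [0..<N]"
  define ys where "ys = rev (sort xs)"
  define al where "al = part_of (pt ys)"
  have "mset ys = mset xs" by (simp add: ys_def)
  then obtain p where p: "p permutes {..<length xs}" and ys: "permute_list p xs = ys"
    by (rule mset_eq_permutation)
  have len: "length xs = N" "length ys = N" by (simp_all add: ys_def xs_def)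
  have "sorted_wrt (\<ge>) ys"
    by (simp add: ys_def sorted_wrt_rev)
  then have dec: "pt ys (Suc i) \<le> pt ys i" for i
    by (auto simp: pt_def sorted_wrt_iff_nth_less)
  have zero: "pt ys N = 0" by (simp add: pt_def len)
  have al: "is_partition al" and pt_al: "pt al i = pt ys i" for i
    unfolding al_def by (rule is_partition_part_of pt_part_of; rule dec zero)+
  have eq: "Poly_Mapping.map_key p m = pmon al"
  proof (rule poly_mapping_eqI)
    fix i
    show "Poly_Mapping.lookup (Poly_Mapping.map_key p m) i = Poly_Mapping.lookup (pmon al) i"
    proof (cases "i < N")
      case True
      then have "p i < N" using permutes_in_image[OF p, of i] by (simp add: len)
      have "pt ys i = xs ! p i"
        using True permute_list_nth[OF p, of i] by (simp add: pt_def len ys)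
      then show ?thesis
        using \<open>p i < N\<close> by (simp add: lookup_map_key permutes_inj[OF p] lookup_pmon pt_al xs_def)
    next
      case False
      then have "p i = i" using permutes_not_in[OF p, of i] by (simp add: len)
      moreover have "Poly_Mapping.lookup m i = 0" using False m by (auto simp: in_keys_iff)
      ultimately show ?thesis
        using False by (simp add: lookup_map_key permutes_inj[OF p] lookup_pmon pt_al pt_eq_0 len)
    qed
  qed
  have "f m = f (pmon al)" if "symm f" for f
    using that p m eq by (metis len(1) symm_def)
  moreover have "mdeg m = mdeg (pmon al)"
  proof -
    have "mdeg m = sum_list xs"
      using m by (simp add: mdeg_superset[of "{..<N}"] xs_def sum_list_sum_nth atLeast0LessThan)
    also have "\<dots> = sum_list ys" using \<open>mset ys = mset xs\<close> by (metis sum_mset_sum_list)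
    also have "\<dots> = (\<Sum>i<N. pt ys i)" by (simp add: sum_list_sum_nth len pt_def atLeast0LessThan)
    also have "\<dots> = sum_list al" using al zero by (simp add: sum_list_pt[of al N] pt_al)
    finally show ?thesis by (simp add: mdeg_pmon)
  qed
  ultimately show ?thesis using al by (auto simp: mdeg_pmon parts_def)
qed

section \<open>Pieri rule, Cauchy identity, and counting matrices\<close>

section \<open>The Cauchy identity\<close>

lemma parts_0: "parts 0 = {[]}"
proof -
  have "x = []" if "x \<in> parts 0" for x
    using that by (cases x) (auto simp: parts_def is_partition_def)
  moreover have "[] \<in> parts 0" by (simp add: parts_def is_partition_def)
  ultimately show ?thesis by blast
qed

lemma splits_monom_0: "splits (0 :: monom) = {(0, 0)}"
proof -
  have *: "a = 0 \<and> b = 0" if "a + b = 0" for a b :: monom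
    using arg_cong[OF that, of mdeg] by simp
  have "x \<in> splits 0 \<longleftrightarrow> x \<in> {(0, 0)}" for x :: "monom \<times> monom"
    using *[of "fst x" "snd x"] by (cases x) auto
  then show ?thesis unfolding set_eq_iff by blast
qed

text \<open>A factorisation is determined by its part in the earlier variables and the exponent
  \<open>i\<close> of variable \<open>N\<close> in the first factor; the degree condition bounds
  \<open>i\<close> by \<open>b\<close>.\<close>

lemma sum_monom_splits_last:
  fixes g :: "monom \<Rightarrow> 'a::comm_monoid_add"
  assumes keys: "Poly_Mapping.keys a \<subseteq> {..<N}"
  shows "(\<Sum>(d, d')\<in>{(d, d') \<in> splits (a + Poly_Mapping.single N k). mdeg d = b}. g d') =
    (\<Sum>i\<le>min k b. \<Sum>(c, c')\<in>{(c, c') \<in> splits a. mdeg c = b - i}. g (c' + Poly_Mapping.single N (k - i)))"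
proof -
  let ?A = "{(d, d') \<in> splits (a + Poly_Mapping.single N k). mdeg d = b}"
  let ?S = "\<lambda>i. {(c, c') \<in> splits a. mdeg c = b - i}"
  let ?B = "SIGMA i:{..min k b}. ?S i"
  let ?F = "\<lambda>(d, d'). (Poly_Mapping.lookup d N, (Poly_Mapping.update N 0 d, Poly_Mapping.update N 0 d'))"
  let ?G = "\<lambda>(i, (c, c')). (c + Poly_Mapping.single N i, c' + Poly_Mapping.single N (k - i))"
  have fin: "finite (?S i)" for i by (rule finite_subset[OF _ finite_splits_monom[of a]]) auto
  have aN: "Poly_Mapping.lookup a N = 0" using keys by (auto simp: in_keys_iff)
  have upd: "Poly_Mapping.update N 0 d + Poly_Mapping.single N (Poly_Mapping.lookup d N) = d" for d :: monom
    by (rule poly_mapping_eqI) (auto simp: lookup_add lookup_update lookup_single)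
  have upd2: "Poly_Mapping.update N 0 (c + Poly_Mapping.single N i) = c"
    if "Poly_Mapping.lookup c N = 0" for c :: monom and i
    using that by (intro poly_mapping_eqI) (auto simp: lookup_add lookup_update lookup_single)
  have "(\<Sum>(d, d')\<in>?A. g d') = (\<Sum>(i, (c, c'))\<in>?B. g (c' + Poly_Mapping.single N (k - i)))"
  proof (rule sum.reindex_bij_witness[of _ ?G ?F])
    fix x assume x: "x \<in> ?A"
    obtain d d' where [simp]: "x = (d, d')" by (cases x)
    have sum: "d + d' = a + Poly_Mapping.single N k" and deg: "mdeg d = b" using x by auto
    have dN: "Poly_Mapping.lookup d N + Poly_Mapping.lookup d' N = k"
      using arg_cong[OF sum, of "\<lambda>x. Poly_Mapping.lookup x N"] aN by (simp add: lookup_add)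
    then have k: "k - Poly_Mapping.lookup d N = Poly_Mapping.lookup d' N" by simp
    show "?G (?F x) = x" by (simp add: k upd)
    show "(case ?F x of (i, (c, c')) \<Rightarrow> g (c' + Poly_Mapping.single N (k - i))) = (case x of (d, d') \<Rightarrow> g d')"
      by (simp add: k upd)
    have "Poly_Mapping.update N 0 d + Poly_Mapping.update N 0 d' = a"
    proof (rule poly_mapping_eqI)
      fix i show "Poly_Mapping.lookup (Poly_Mapping.update N 0 d + Poly_Mapping.update N 0 d') i = Poly_Mapping.lookup a i"
        using arg_cong[OF sum, of "\<lambda>x. Poly_Mapping.lookup x i"] aN
        by (auto simp: lookup_add lookup_update lookup_single)
    qed
    moreover have "mdeg (Poly_Mapping.update N 0 d) = b - Poly_Mapping.lookup d N"
      using arg_cong[OF upd[of d], of mdeg] deg by simp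
    moreover have "Poly_Mapping.lookup d N \<le> b" using lookup_le_mdeg[of d N] deg by simp
    ultimately show "?F x \<in> ?B" using dN by simp
  next
    fix y assume y: "y \<in> ?B"
    obtain i c c' where [simp]: "y = (i, (c, c'))" by (cases y)
    have sum: "c + c' = a" and deg: "mdeg c = b - i" and i: "i \<le> k" "i \<le> b" using y by auto
    have cN: "Poly_Mapping.lookup c N = 0" "Poly_Mapping.lookup c' N = 0"
      using arg_cong[OF sum, of "\<lambda>x. Poly_Mapping.lookup x N"] aN by (simp_all add: lookup_add)
    show "?F (?G y) = y" by (simp add: cN upd2 lookup_add)
    have "(c + Poly_Mapping.single N i) + (c' + Poly_Mapping.single N (k - i)) =
        (c + c') + Poly_Mapping.single N (i + (k - i))"
      by (simp only: single_add add.assoc add.commute add.left_commute)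
    then show "?G y \<in> ?A" using sum deg i by simp
  qed
  also have "\<dots> = (\<Sum>i\<le>min k b. \<Sum>(c, c')\<in>?S i. g (c' + Poly_Mapping.single N (k - i)))"
    using fin by (subst sum.Sigma) auto
  finally show ?thesis .
qed

text \<open>Both sides are the coefficient of \<open>a\<close> in \<open>h\<^sub>b s\<^sub>\<nu>\<close>, since every coefficient of \<open>h\<^sub>b\<close> is 1.\<close>

lemma schur_pieri:
  assumes "Poly_Mapping.keys a \<subseteq> {..<N}" "is_partition nu"
  shows "(\<Sum>lam\<in>up nu b. schur lam a) = (\<Sum>(c, c')\<in>{(c, c') \<in> splits a. mdeg c = b}. schur nu c')"
  using assms
proof (induction N a arbitrary: nu b rule: monom_bounded_induct)
  case zero
  have "{(c, c') \<in> splits (0::monom). mdeg c = b} = (if b = 0 then {(0, 0)} else {})"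
    by (auto simp: splits_monom_0)
  moreover have "up nu b \<inter> {[]} = (if nu = [] \<and> b = 0 then {[]} else {})"
  proof -
    have "hs nu [] \<longleftrightarrow> nu = []"
    proof
      assume "hs nu []"
      then have "pt nu 0 \<le> pt [] 0" unfolding hs_def by blast
      then have "pt nu 0 = 0" by (simp add: pt_eq_0)
      then show "nu = []" using zero.prems by (simp add: pt_eq_0_iff)
    qed (simp add: hs_def pt_def)
    then show ?thesis by (auto simp: up_def is_partition_def)
  qed
  moreover have "(\<Sum>lam\<in>up nu b. schur lam 0) = (\<Sum>lam\<in>up nu b. if lam = [] then 1 else 0)"
    by (rule sum.cong) (auto simp: up_def schur_0)
  ultimately show ?case
    using zero.prems by (auto simp: schur_0 sum.If_cases Collect_conv_if)
next
  case (step N m k)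
  have "(\<Sum>lam\<in>up nu b. schur lam (m + Poly_Mapping.single N k)) =
      (\<Sum>lam\<in>up nu b. \<Sum>mu\<in>down lam k. schur mu m)"
    using step.hyps by (intro sum.cong) (auto simp: up_def schur_branch)
  \<comment> \<open>Commuting the two strips produces the same sum over \<open>i\<close> as
    splitting the exponent of the last variable.\<close>
  also have "\<dots> = (\<Sum>i\<le>min k b. \<Sum>kap\<in>down nu (k - i). \<Sum>mu\<in>up kap (b - i). schur mu m)"
    by (rule sum_up_down_commute) fact
  also have "\<dots> = (\<Sum>i\<le>min k b. \<Sum>kap\<in>down nu (k - i).
      \<Sum>(c, c')\<in>{(c, c') \<in> splits m. mdeg c = b - i}. schur kap c')"
    by (intro sum.cong refl step.IH) (simp add: down_def)
  also have "\<dots> = (\<Sum>i\<le>min k b. \<Sum>(c, c')\<in>{(c, c') \<in> splits m. mdeg c = b - i}.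
      \<Sum>kap\<in>down nu (k - i). schur kap c')"
    unfolding case_prod_unfold by (intro sum.cong refl sum.swap)
  also have "\<dots> = (\<Sum>i\<le>min k b. \<Sum>(c, c')\<in>{(c, c') \<in> splits m. mdeg c = b - i}.
      schur nu (c' + Poly_Mapping.single N (k - i)))"
  proof (intro sum.cong refl, clarify)
    fix i c c' assume "(c, c') \<in> splits m"
    then have "Poly_Mapping.keys c' \<subseteq> {..<N}"
      using step.hyps by (auto simp: in_keys_iff lookup_add subset_iff)
    then show "(\<Sum>kap\<in>down nu (k - i). schur kap c') = schur nu (c' + Poly_Mapping.single N (k - i))"
      using step.prems by (simp add: schur_branch)
  qed
  also have "\<dots> = (\<Sum>(c, c')\<in>{(c, c') \<in> splits (m + Poly_Mapping.single N k). mdeg c = b}. schur nu c')"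
    by (rule sum_monom_splits_last[OF step.hyps(1), symmetric])
  finally show ?case .
qed

text \<open>A bijection from multisets of variable indices to monomials, through which exponent
  vectors are handled as multisets of labels.\<close>

definition cont :: "nat multiset \<Rightarrow> monom" where
  "cont M = (\<Sum>x\<in>#M. Poly_Mapping.single x 1)"

lemma cont_simps [simp]:
  "cont {#} = 0" "cont (add_mset x M) = Poly_Mapping.single x 1 + cont M" "cont (M + M') = cont M + cont M'"
  by (simp_all add: cont_def)

lemma lookup_cont: "Poly_Mapping.lookup (cont M) i = count M i"
  by (induction M) (auto simp: lookup_add lookup_single)

lemma mdeg_cont: "mdeg (cont M) = size M"
  by (induction M) auto

lemma keys_cont: "Poly_Mapping.keys (cont M) = set_mset M"
  by (auto simp: in_keys_iff lookup_cont)

lemma cont_inject: "cont M = cont M' \<longleftrightarrow> M = M'"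
  by (metis lookup_cont multiset_eq_iff)

lemma cont_surj: "\<exists>M. cont M = m"
proof -
  have "cont (Abs_multiset (Poly_Mapping.lookup m)) = m"
    by (rule poly_mapping_eqI) (simp add: lookup_cont Abs_multiset_inverse)
  then show ?thesis ..
qed

text \<open>Multisets of labelled elements encode nonnegative integer matrices and 3-tensors with
  prescribed margins.\<close>

definition labelled :: "('u multiset \<Rightarrow> 'm) \<Rightarrow> 'm \<Rightarrow> monom \<Rightarrow> ('u \<times> nat) multiset set" where
  "labelled W a m = {E. W (image_mset fst E) = a \<and> cont (image_mset snd E) = m}"

text \<open>The elements labelled \<open>N\<close> form a multiset \<open>e\<close> of size
  \<open>k\<close>; removing them leaves the margin \<open>m\<close>. The weight \<open>W\<close> is
  abstract, as it is \<open>cont\<close> for matrices and \<open>margins\<close> for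
  tensors.\<close>

lemma
  fixes W :: "'u multiset \<Rightarrow> 'm::comm_monoid_add"
  assumes W: "\<And>x y. W (x + y) = W x + W y" and keys: "Poly_Mapping.keys m \<subseteq> {..<N}"
    and fin_splits: "finite (splits a)"
    and fin: "\<And>c. finite {e. W e = c \<and> size e = k}"
    and fin_rec: "\<And>c. finite (labelled W c m)"
  shows finite_labelled_step: "finite (labelled W a (m + Poly_Mapping.single N k))"
    and card_labelled_step: "card (labelled W a (m + Poly_Mapping.single N k)) =
      (\<Sum>(c, c')\<in>splits a. card {e. W e = c \<and> size e = k} * card (labelled W c' m))"
proof -
  let ?S = "SIGMA x:splits a. {e. W e = fst x \<and> size e = k} \<times> labelled W (snd x) m"
  define G where "G = (\<lambda>(x :: 'm \<times> 'm, e :: 'u multiset, E). E + image_mset (\<lambda>u. (u, N)) e)"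
  have small: "snd z \<noteq> N" if "E \<in> labelled W c m" "z \<in># E" for E c z
  proof -
    have "snd z \<in> Poly_Mapping.keys (cont (image_mset snd E))"
      using that by (simp add: keys_cont)
    then show ?thesis using that keys by (auto simp: labelled_def)
  qed
  \<comment> \<open>Filtering by the label \<open>N\<close> recovers both pieces, since no element
    of \<open>E\<close> carries that label.\<close>
  have rest: "filter_mset (\<lambda>z. snd z \<noteq> N) (G (x, e, E)) = E"
    and last: "image_mset fst (filter_mset (\<lambda>z. snd z = N) (G (x, e, E))) = e"
    if "E \<in> labelled W c m" for x e E c
  proof -
    have f1: "filter_mset (\<lambda>z. snd z \<noteq> N) E = E" and f2: "filter_mset (\<lambda>z. snd z = N) E = {#}"
      using small[OF that]
        filter_mset_cong[OF refl, of E "\<lambda>z. snd z \<noteq> N" "\<lambda>_. True"]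
        filter_mset_cong[OF refl, of E "\<lambda>z. snd z = N" "\<lambda>_. False"] by auto
    show "filter_mset (\<lambda>z. snd z \<noteq> N) (G (x, e, E)) = E"
      "image_mset fst (filter_mset (\<lambda>z. snd z = N) (G (x, e, E))) = e"
      by (simp_all add: G_def f1 f2 filter_mset_image_mset comp_def multiset.map_comp)
  qed
  have inj: "inj_on G ?S"
  proof (rule inj_onI)
    fix y y' assume y: "y \<in> ?S" "y' \<in> ?S" and eq: "G y = G y'"
    obtain x e E x' e' E' where [simp]: "y = (x, e, E)" "y' = (x', e', E')" by (cases y, cases y')
    have E: "E \<in> labelled W (snd x) m" "E' \<in> labelled W (snd x') m" using y by auto
    have "E = E'" "e = e'"
      using eq rest[OF E(1), of x e] rest[OF E(2), of x' e'] last[OF E(1), of x e] last[OF E(2), of x' e']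
      by simp_all
    moreover have "x = (W e, W (image_mset fst E))" "x' = (W e', W (image_mset fst E'))"
      using y by (auto simp: labelled_def prod_eq_iff)
    ultimately show "y = y'" by simp
  qed
  have img: "G ` ?S = labelled W a (m + Poly_Mapping.single N k)"
  proof (intro equalityI subsetI)
    fix z assume "z \<in> G ` ?S"
    then obtain c c' e E where z: "z = E + image_mset (\<lambda>u. (u, N)) e" and a: "a = c + c'"
      and e: "W e = c" "size e = k" and E: "W (image_mset fst E) = c'" "cont (image_mset snd E) = m"
      by (auto simp: G_def labelled_def)
    have "cont (image_mset (\<lambda>_. N) e) = Poly_Mapping.single N (size e)"
      by (induction e) (auto simp: single_add[symmetric])
    then show "z \<in> labelled W a (m + Poly_Mapping.single N k)"
      using e E by (simp add: labelled_def z a W multiset.map_comp comp_def add.commute)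
  next
    fix z assume z: "z \<in> labelled W a (m + Poly_Mapping.single N k)"
    define E where "E = filter_mset (\<lambda>z. snd z \<noteq> N) z"
    define e where "e = image_mset fst (filter_mset (\<lambda>z. snd z = N) z)"
    have zE: "z = E + image_mset (\<lambda>u. (u, N)) e"
    proof -
      have "image_mset (\<lambda>u. (u, N)) e = filter_mset (\<lambda>z. snd z = N) z"
        by (auto simp: e_def multiset.map_comp intro!: image_mset_cong[THEN trans, OF _ multiset.map_ident])
      then show ?thesis by (simp add: E_def)
    qed
    have lookupm: "Poly_Mapping.lookup m N = 0" using keys by (auto simp: in_keys_iff)
    have cont_z: "cont (image_mset snd E) + Poly_Mapping.single N (size e) = m + Poly_Mapping.single N k"
    proof -
      have "cont (image_mset (\<lambda>_. N) e) = Poly_Mapping.single N (size e)" for e :: "'u multiset"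
        by (induction e) (auto simp: single_add[symmetric])
      then show ?thesis
        using z unfolding labelled_def zE by (simp add: multiset.map_comp comp_def)
    qed
    have "count (image_mset snd E) N = 0"
      by (auto simp: E_def count_eq_zero_iff)
    then have "size e = k"
      using arg_cong[OF cont_z, of "\<lambda>x. Poly_Mapping.lookup x N"] lookupm
      by (simp add: lookup_add lookup_cont)
    then have "cont (image_mset snd E) = m" using cont_z by simp
    moreover have "W e + W (image_mset fst E) = a"
      using z unfolding labelled_def zE by (simp add: multiset.map_comp comp_def W add.commute)
    ultimately have "((W e, W (image_mset fst E)), e, E) \<in> ?S"
      using \<open>size e = k\<close> by (simp add: labelled_def)
    then show "z \<in> G ` ?S" by (rule rev_image_eqI) (simp add: G_def zE)
  qed
  have finS: "finite ?S"
    using fin_splits fin fin_rec by (intro finite_SigmaI) auto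
  then show "finite (labelled W a (m + Poly_Mapping.single N k))"
    unfolding img[symmetric] by (rule finite_imageI)
  have "card (labelled W a (m + Poly_Mapping.single N k)) = card ?S"
    unfolding img[symmetric] by (rule card_image[OF inj])
  also have "\<dots> = (\<Sum>x\<in>splits a. card ({e. W e = fst x \<and> size e = k} \<times> labelled W (snd x) m))"
    using fin_splits fin fin_rec by (intro card_SigmaI) auto
  finally show "card (labelled W a (m + Poly_Mapping.single N k)) =
      (\<Sum>(c, c')\<in>splits a. card {e. W e = c \<and> size e = k} * card (labelled W c' m))"
    by (simp add: card_cartesian_product case_prod_unfold)
qed

lemma labelled_zero: "labelled W a 0 = (if W {#} = a then {{#}} else {})"
  using cont_inject[of _ "{#}"] by (auto simp: labelled_def)

text \<open>These are the coefficients of the complete symmetric function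
  \<open>h\<^sub>k\<close>.\<close>

lemma cont_fiber: "card {e. cont e = c \<and> size e = k} = (if mdeg c = k then 1 else 0)"
    "finite {e. cont e = c \<and> size e = k}"
proof -
  obtain M where "c = cont M" using cont_surj by metis
  then have "{e. cont e = c \<and> size e = k} = (if mdeg c = k then {M} else {})"
    by (auto simp: cont_inject mdeg_cont)
  then show "card {e. cont e = c \<and> size e = k} = (if mdeg c = k then 1 else 0)"
    "finite {e. cont e = c \<and> size e = k}" by auto
qed

text \<open>Branching on the last variable of \<open>b\<close>, followed by the Pieri rule at
  \<open>a\<close>, matches taking off the last column of a matrix. Finiteness is carried along
  because the recursion for cardinalities requires it.\<close>

lemma schur_cauchy:
  assumes "Poly_Mapping.keys b \<subseteq> {..<N}"
  shows "finite (labelled cont a b) \<and>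
    (\<Sum>mu\<in>parts (mdeg b). schur mu a * schur mu b) = int (card (labelled cont a b))"
  using assms
proof (induction N b arbitrary: a rule: monom_bounded_induct)
  case zero
  show ?case by (simp add: parts_0 labelled_zero schur_Nil mone_def)
next
  case (step N b k)
  have fin_rec: "finite (labelled cont c b)" for c using step.IH by blast
  have "(\<Sum>lam\<in>parts (mdeg (b + Poly_Mapping.single N k)). schur lam a * schur lam (b + Poly_Mapping.single N k)) =
      (\<Sum>lam\<in>parts (mdeg b + k). \<Sum>nu\<in>down lam k. schur lam a * schur nu b)"
    using step.hyps by (auto simp: schur_branch parts_def sum_distrib_left intro!: sum.cong)
  also have "\<dots> = (\<Sum>(lam, nu)\<in>(SIGMA lam:parts (mdeg b + k). down lam k). schur lam a * schur nu b)"
    by (simp add: sum.Sigma)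
  \<comment> \<open>The strip is now read from below, as \<open>k\<close> cells added to
    \<open>nu\<close>, which is the form the Pieri rule sums over.\<close>
  also have "\<dots> = (\<Sum>(nu, lam)\<in>(SIGMA nu:parts (mdeg b). up nu k). schur lam a * schur nu b)"
    by (rule sum.reindex_bij_witness[of _ prod.swap prod.swap])
       (auto simp: parts_def up_def down_def)
  also have "\<dots> = (\<Sum>nu\<in>parts (mdeg b). (\<Sum>lam\<in>up nu k. schur lam a) * schur nu b)"
    by (simp add: sum.Sigma[symmetric] sum_distrib_right)
  also have "\<dots> = (\<Sum>nu\<in>parts (mdeg b). \<Sum>(c, c')\<in>{(c, c') \<in> splits a. mdeg c = k}. schur nu c' * schur nu b)"
  proof -
    obtain M where "Poly_Mapping.keys a \<subseteq> {..<M}" using keys_subset_lessThan_ex by blast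
    then show ?thesis
      by (intro sum.cong refl) (auto simp: schur_pieri parts_def sum_distrib_right case_prod_unfold)
  qed
  also have "\<dots> = (\<Sum>(c, c')\<in>{(c, c') \<in> splits a. mdeg c = k}. \<Sum>nu\<in>parts (mdeg b). schur nu c' * schur nu b)"
    unfolding case_prod_unfold by (rule sum.swap)
  also have "\<dots> = (\<Sum>(c, c')\<in>{(c, c') \<in> splits a. mdeg c = k}. int (card (labelled cont c' b)))"
    using step.IH by simp
  also have "\<dots> = (\<Sum>(c, c')\<in>splits a. int (card {e. cont e = c \<and> size e = k}) * int (card (labelled cont c' b)))"
    by (rule sum.mono_neutral_cong_left) (auto simp: cont_fiber split: if_splits)
  also have "\<dots> = int (card (labelled cont a (b + Poly_Mapping.single N k)))"
    by (subst card_labelled_step[OF _ step.hyps(1)]) (auto simp: cont_fiber fin_rec case_prod_unfold)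
  finally show ?case
    using finite_labelled_step[OF _ step.hyps(1), of cont a k] fin_rec by (simp add: cont_fiber)
qed

text \<open>A multiset of pairs is a nonnegative integer matrix. With its row and column sums as
  weight, \<open>labelled\<close> describes 3-tensors.\<close>

definition margins :: "(nat \<times> nat) multiset \<Rightarrow> monom \<times> monom" where
  "margins e = (cont (image_mset fst e), cont (image_mset snd e))"

lemma margins_add: "margins (x + y) = margins x + margins y"
  by (simp add: margins_def)

text \<open>The Cauchy identity for matrices of entry sum \<open>k\<close>. If \<open>mdeg d\<close>
  differs from \<open>k\<close>, there is no such matrix and the Schur functions vanish at
  \<open>d\<close>.\<close>

lemma
  shows finite_margins_fiber: "finite {e. margins e = (c, d) \<and> size e = k}"
    and card_margins_fiber:
      "int (card {e. margins e = (c, d) \<and> size e = k}) = (\<Sum>mu\<in>parts k. schur mu c * schur mu d)"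
proof -
  obtain N where N: "Poly_Mapping.keys d \<subseteq> {..<N}" using keys_subset_lessThan_ex by blast
  have "size e = mdeg (cont (image_mset snd e))" for e :: "(nat \<times> nat) multiset"
    by (simp add: mdeg_cont)
  then have eq: "{e. margins e = (c, d) \<and> size e = k} = (if mdeg d = k then labelled cont c d else {})"
    by (auto simp: margins_def labelled_def)
  then show "finite {e. margins e = (c, d) \<and> size e = k}"
    using schur_cauchy[OF N, of c] by simp
  show "int (card {e. margins e = (c, d) \<and> size e = k}) = (\<Sum>mu\<in>parts k. schur mu c * schur mu d)"
  proof (cases "mdeg d = k")
    case True
    then show ?thesis unfolding eq using schur_cauchy[OF N, of c] by simp
  next
    case False
    then have "schur mu d = 0" if "mu \<in> parts k" for mu
      using that by (intro homogD[OF homog_schur]) (auto simp: parts_def)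
    then show ?thesis unfolding eq using False by simp
  qed
qed

section \<open>Sequences of partitions, products of Schur functions, and counting 3-tensors\<close>

definition part_seqs :: "monom \<Rightarrow> (nat \<Rightarrow> nat list) set" where
  "part_seqs m = {mus. \<forall>j. mus j \<in> parts (Poly_Mapping.lookup m j)}"

text \<open>A fixed number of factors in place of \<open>seq_len mus\<close> allows summation over
  sequences; surplus factors are \<open>schur []\<close>, which is 1.\<close>

definition schur_prod :: "nat \<Rightarrow> (nat \<Rightarrow> nat list) \<Rightarrow> mfps" where
  "schur_prod N mus = mprod_list (map (\<lambda>j. schur (mus j)) [0..<N])"

lemma finite_part_seqs [simp, intro]: "finite (part_seqs m)"
proof (rule finite_subset)
  let ?B = "\<Union>j\<in>Poly_Mapping.keys m. parts (Poly_Mapping.lookup m j)"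
  show "part_seqs m \<subseteq>
    {f. \<forall>j. (j \<in> Poly_Mapping.keys m \<longrightarrow> f j \<in> ?B) \<and> (j \<notin> Poly_Mapping.keys m \<longrightarrow> f j = [])}"
  proof (intro subsetI CollectI allI conjI impI)
    fix mus j assume mus: "mus \<in> part_seqs m"
    then have *: "mus j \<in> parts (Poly_Mapping.lookup m j)" by (simp add: part_seqs_def)
    show "mus j \<in> ?B" if "j \<in> Poly_Mapping.keys m" using * that by blast
    show "mus j = []" if "j \<notin> Poly_Mapping.keys m"
      using * that by (simp add: in_keys_iff parts_0)
  qed
  show "finite {f. \<forall>j. (j \<in> Poly_Mapping.keys m \<longrightarrow> f j \<in> ?B) \<and> (j \<notin> Poly_Mapping.keys m \<longrightarrow> f j = [])}"
    by (intro finite_set_of_finite_funs) auto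
qed

lemma sum_part_seqs_step:
  fixes g :: "(nat \<Rightarrow> nat list) \<Rightarrow> 'a::comm_monoid_add"
  assumes "Poly_Mapping.keys m \<subseteq> {..<N}"
  shows "(\<Sum>mus\<in>part_seqs (m + Poly_Mapping.single N k). g mus) =
    (\<Sum>mus\<in>part_seqs m. \<Sum>mu\<in>parts k. g (mus(N := mu)))"
proof -
  have mN: "Poly_Mapping.lookup m N = 0" using assms by (auto simp: in_keys_iff)
  have "(\<Sum>mus\<in>part_seqs (m + Poly_Mapping.single N k). g mus) =
      (\<Sum>(mus, mu)\<in>part_seqs m \<times> parts k. g (mus(N := mu)))"
  proof (rule sum.reindex_bij_witness[of _ "\<lambda>(mus, mu). mus(N := mu)" "\<lambda>mus. (mus(N := []), mus N)"])
    fix mus assume "mus \<in> part_seqs (m + Poly_Mapping.single N k)"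
    then have *: "mus j \<in> parts (Poly_Mapping.lookup m j + (if j = N then k else 0))" for j
      by (auto simp: part_seqs_def lookup_add lookup_single when_def split: if_splits)
    show "(mus(N := []), mus N) \<in> part_seqs m \<times> parts k"
      using *[of N] mN * by (auto simp: part_seqs_def parts_0 split: if_splits) (metis add.right_neutral *)
  next
    fix x assume "x \<in> part_seqs m \<times> parts k"
    then obtain mus mu where [simp]: "x = (mus, mu)" and mus: "mus \<in> part_seqs m" and "mu \<in> parts k"
      by auto
    have "mus N = []" using mus mN by (auto simp: part_seqs_def parts_0 dest: spec[of _ N])
    then show "((case x of (mus, mu) \<Rightarrow> mus(N := mu))(N := []), (case x of (mus, mu) \<Rightarrow> mus(N := mu)) N) = x"
      by (auto simp: fun_eq_iff)
    show "(case x of (mus, mu) \<Rightarrow> mus(N := mu)) \<in> part_seqs (m + Poly_Mapping.single N k)"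
      using mus mN \<open>mu \<in> parts k\<close> by (auto simp: part_seqs_def lookup_add lookup_single)
  qed auto
  then show ?thesis by (simp add: sum.cartesian_product)
qed

lemma schur_prod_upd: "schur_prod (Suc N) (mus(N := mu)) = mmult (schur mu) (schur_prod N mus)"
proof -
  have "map (\<lambda>j. schur ((mus(N := mu)) j)) [0..<Suc N] = map (\<lambda>j. schur (mus j)) [0..<N] @ [schur mu]"
    by simp
  then show ?thesis
    unfolding schur_prod_def by (simp only: mprod_list_append) (simp add: mmult_comm)
qed

text \<open>The layer with index \<open>N\<close> of a 3-tensor is a matrix of entry sum
  \<open>k\<close>, counted by the Cauchy identity for the one new partition; the margins of this
  layer and of the rest are convolved.\<close>

lemma sum_schur_prod_prod:
  assumes "Poly_Mapping.keys m \<subseteq> {..<N}"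
  shows "finite (labelled margins (a, b) m) \<and>
    (\<Sum>mus\<in>part_seqs m. schur_prod N mus a * schur_prod N mus b) = int (card (labelled margins (a, b) m))"
  using assms
proof (induction N m arbitrary: a b rule: monom_bounded_induct)
  case zero
  have "part_seqs 0 = {\<lambda>_. []}" by (auto simp: part_seqs_def parts_0)
  then show ?case by (auto simp: labelled_zero schur_prod_def mone_def margins_def)
next
  case (step N m k)
  have fin_rec: "finite (labelled margins c m)" for c using step.IH by (cases c) blast
  let ?P = "schur_prod N"
  have "(\<Sum>mus\<in>part_seqs (m + Poly_Mapping.single N k). schur_prod (Suc N) mus a * schur_prod (Suc N) mus b) =
      (\<Sum>mus\<in>part_seqs m. \<Sum>mu\<in>parts k. mmult (schur mu) (?P mus) a * mmult (schur mu) (?P mus) b)"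
    by (simp add: sum_part_seqs_step[OF step.hyps(1)] schur_prod_upd)
  also have "\<dots> = (\<Sum>mus\<in>part_seqs m. \<Sum>mu\<in>parts k. \<Sum>x\<in>splits a. \<Sum>y\<in>splits b.
      (schur mu (fst x) * schur mu (fst y)) * (?P mus (snd x) * ?P mus (snd y)))"
    by (simp add: mmult_splits case_prod_unfold sum_product mult_ac)
  also have "\<dots> = (\<Sum>mus\<in>part_seqs m. \<Sum>mu\<in>parts k. \<Sum>z\<in>splits a \<times> splits b.
      (schur mu (fst (fst z)) * schur mu (fst (snd z))) * (?P mus (snd (fst z)) * ?P mus (snd (snd z))))"
    by (simp add: sum.cartesian_product case_prod_unfold)
  also have "\<dots> = (\<Sum>z\<in>splits a \<times> splits b. \<Sum>mus\<in>part_seqs m. \<Sum>mu\<in>parts k.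
      (schur mu (fst (fst z)) * schur mu (fst (snd z))) * (?P mus (snd (fst z)) * ?P mus (snd (snd z))))"
    by (subst sum.swap[of _ "splits a \<times> splits b"]) (intro sum.cong refl sum.swap)
  also have "\<dots> = (\<Sum>z\<in>splits a \<times> splits b.
      (\<Sum>mu\<in>parts k. schur mu (fst (fst z)) * schur mu (fst (snd z))) *
      (\<Sum>mus\<in>part_seqs m. ?P mus (snd (fst z)) * ?P mus (snd (snd z))))"
    by (simp add: sum_distrib_left sum_distrib_right)
  also have "\<dots> = (\<Sum>((c, c'), (d, d'))\<in>splits a \<times> splits b.
      int (card {e. margins e = (c, d) \<and> size e = k} * card (labelled margins (c', d') m)))"
    using step.IH by (simp add: card_margins_fiber case_prod_unfold)
  \<comment> \<open>Splitting \<open>a\<close> and \<open>b\<close> independently is splitting the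
    pair, as in the recursion for tensors.\<close>
  also have "\<dots> = (\<Sum>(c, c')\<in>splits (a, b).
      int (card {e. margins e = c \<and> size e = k} * card (labelled margins c' m)))"
    unfolding splits_Pair by (subst sum.reindex) (auto simp: inj_on_def case_prod_unfold)
  also have "\<dots> = int (card (labelled margins (a, b) (m + Poly_Mapping.single N k)))"
    by (subst card_labelled_step[OF _ step.hyps(1)])
       (auto simp: margins_add finite_margins_fiber fin_rec case_prod_unfold)
  finally have "(\<Sum>mus\<in>part_seqs (m + Poly_Mapping.single N k). schur_prod (Suc N) mus a * schur_prod (Suc N) mus b) =
      int (card (labelled margins (a, b) (m + Poly_Mapping.single N k)))" .
  moreover have "finite (labelled margins (a, b) (m + Poly_Mapping.single N k))"
    by (rule finite_labelled_step[OF _ step.hyps(1)])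
       (auto simp: margins_add finite_margins_fiber fin_rec)
  ultimately show ?case by blast
qed

section \<open>The number of 3-tensors in terms of power sum coefficients\<close>

section \<open>Expansion into power sums\<close>

text \<open>Compositions, since the recursion below splits off an arbitrary first part.\<close>

definition comps :: "nat \<Rightarrow> nat list set" where
  "comps n = {l. 0 \<notin> set l \<and> sum_list l = n}"

lemma finite_comps [simp, intro]: "finite (comps n)"
  using finite_nat_lists_sum[of n] by (simp add: comps_def)

definition reps :: "nat list \<Rightarrow> 'u list \<Rightarrow> 'u multiset" where
  "reps l xs = sum_list (map2 replicate_mset l xs)"

text \<open>One element is picked for each part of \<open>l\<close> and taken with that
  multiplicity, as when multiplying out a product of power sums. The element type is free, so that
  colourings of a tensor can be projected to its margins.\<close>

definition colourings :: "nat list \<Rightarrow> 'u multiset \<Rightarrow> 'u list set" where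
  "colourings l e = {xs. length xs = length l \<and> reps l xs = e}"

lemma colourings_Nil: "colourings [] e = (if e = {#} then {[]} else {})"
  by (auto simp: colourings_def reps_def)

lemma colourings_Cons:
  assumes "0 < k"
  shows "colourings (k # l) e = (\<Union>x\<in>{x \<in> set_mset e. k \<le> count e x}.
    (#) x ` colourings l (e - replicate_mset k x))"
proof (intro equalityI subsetI)
  fix ys assume ys: "ys \<in> colourings (k # l) e"
  then obtain x xs where [simp]: "ys = x # xs" by (cases ys) (auto simp: colourings_def)
  have e: "replicate_mset k x + reps l xs = e" and len: "length xs = length l"
    using ys by (auto simp: colourings_def reps_def)
  have "k \<le> count e x" using e by auto
  moreover from this have "x \<in># e" using assms by (metis count_inI leD)
  moreover have "xs \<in> colourings l (e - replicate_mset k x)"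
    using e len by (auto simp: colourings_def)
  ultimately show "ys \<in> (\<Union>x\<in>{x \<in> set_mset e. k \<le> count e x}.
      (#) x ` colourings l (e - replicate_mset k x))" by auto
next
  fix ys assume "ys \<in> (\<Union>x\<in>{x \<in> set_mset e. k \<le> count e x}.
      (#) x ` colourings l (e - replicate_mset k x))"
  then obtain x xs where "k \<le> count e x" "ys = x # xs" "length xs = length l"
    "reps l xs = e - replicate_mset k x" by (auto simp: colourings_def)
  then show "ys \<in> colourings (k # l) e"
    by (simp add: colourings_def reps_def count_le_replicate_mset_subset_eq)
qed

lemma finite_colourings: "0 \<notin> set l \<Longrightarrow> finite (colourings l e)"
  by (induction l arbitrary: e) (auto simp: colourings_Nil colourings_Cons)

lemma card_colourings_Cons:
  assumes "0 < k" "0 \<notin> set l"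
  shows "card (colourings (k # l) e) =
    (\<Sum>x\<in>{x \<in> set_mset e. k \<le> count e x}. card (colourings l (e - replicate_mset k x)))"
  unfolding colourings_Cons[OF assms(1)]
  by (subst card_UN_disjoint) (auto simp: finite_colourings assms card_image)

text \<open>Iterating \<open>n h\<^sub>n = \<Sum>\<^sub>k p\<^sub>k h\<^sub>n\<^sub>-\<^sub>k\<close> expands the complete symmetric function \<open>h\<^sub>n\<close> into
  products of power sums indexed by compositions, with the following weights.\<close>

fun comp_weight :: "nat list \<Rightarrow> real" where
  "comp_weight [] = 1"
| "comp_weight (k # l) = comp_weight l / real (sum_list (k # l))"

lemma comps_Suc:
  assumes "0 < n"
  shows "comps n = (\<Union>k\<in>{1..n}. (#) k ` comps (n - k))"
proof (intro equalityI subsetI)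
  fix l assume l: "l \<in> comps n"
  with assms obtain k l' where "l = k # l'" by (cases l) (auto simp: comps_def)
  with l show "l \<in> (\<Union>k\<in>{1..n}. (#) k ` comps (n - k))"
    by (auto simp: comps_def intro!: bexI[of _ k])
qed (auto simp: comps_def)

text \<open>Every coefficient of \<open>h\<^sub>n\<close> is 1. By induction each pair of an element
  \<open>x\<close> and a first part \<open>k\<close> between 1 and \<open>count e x\<close>
  contributes \<open>1 / n\<close>, and there are \<open>n = size e\<close> such pairs.\<close>

lemma sum_comp_weight_colourings:
  "(\<Sum>l\<in>comps (size e). comp_weight l * real (card (colourings l e))) = 1"
proof (induction e rule: measure_induct_rule[where f = size])
  case (less e)
  let ?n = "size e"
  show ?case
  proof (cases "e = {#}")
    case True
    have "comps 0 = {[]}"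
    proof -
      have "x = []" if "x \<in> comps 0" for x
        using that by (cases x) (auto simp: comps_def)
      then show ?thesis by (auto simp: comps_def)
    qed
    then show ?thesis using True by (simp add: colourings_Nil)
  next
    case False
    then have n: "0 < ?n" by (simp add: nonempty_has_size)
    have "(\<Sum>l\<in>comps ?n. comp_weight l * real (card (colourings l e))) =
        (\<Sum>k\<in>{1..?n}. \<Sum>l\<in>(#) k ` comps (?n - k). comp_weight l * real (card (colourings l e)))"
      unfolding comps_Suc[OF n] by (rule sum.UNION_disjoint) auto
    also have "\<dots> = (\<Sum>k\<in>{1..?n}. \<Sum>l\<in>comps (?n - k). comp_weight (k # l) * real (card (colourings (k # l) e)))"
      by (simp add: sum.reindex)
    also have "\<dots> = (\<Sum>k\<in>{1..?n}. \<Sum>l\<in>comps (?n - k). \<Sum>x\<in>{x \<in> set_mset e. k \<le> count e x}.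
        comp_weight l * real (card (colourings l (e - replicate_mset k x))) / real ?n)"
    proof (intro sum.cong refl)
      fix k l assume k: "k \<in> {1..?n}" and l: "l \<in> comps (?n - k)"
      then have "sum_list (k # l) = ?n" "0 < k" "0 \<notin> set l" by (auto simp: comps_def)
      then show "comp_weight (k # l) * real (card (colourings (k # l) e)) =
          (\<Sum>x\<in>{x \<in> set_mset e. k \<le> count e x}.
            comp_weight l * real (card (colourings l (e - replicate_mset k x))) / real ?n)"
        by (simp add: card_colourings_Cons sum_distrib_left sum_divide_distrib del: sum_list.Cons)
    qed
    also have "\<dots> = (\<Sum>k\<in>{1..?n}. \<Sum>x\<in>{x \<in> set_mset e. k \<le> count e x}.
        (\<Sum>l\<in>comps (?n - k). comp_weight l * real (card (colourings l (e - replicate_mset k x)))) / real ?n)"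
      by (subst sum.swap) (simp add: sum_divide_distrib)
    also have "\<dots> = (\<Sum>k\<in>{1..?n}. \<Sum>x\<in>{x \<in> set_mset e. k \<le> count e x}. 1 / real ?n)"
    proof (intro sum.cong refl)
      fix k x assume k: "k \<in> {1..?n}" and x: "x \<in> {x \<in> set_mset e. k \<le> count e x}"
      have "size (e - replicate_mset k x) = ?n - k"
        using x by (simp add: size_Diff_submset count_le_replicate_mset_subset_eq)
      moreover have "size (e - replicate_mset k x) < ?n" using calculation k n by auto
      ultimately show "(\<Sum>l\<in>comps (?n - k). comp_weight l * real (card (colourings l (e - replicate_mset k x)))) / real ?n
          = 1 / real ?n"
        using less.IH[of "e - replicate_mset k x"] by simp
    qed
    also have "\<dots> = (\<Sum>x\<in>set_mset e. \<Sum>k\<in>{k \<in> {1..?n}. k \<le> count e x}. 1 / real ?n)"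
      by (rule sum.swap_restrict) auto
    also have "\<dots> = (\<Sum>x\<in>set_mset e. real (count e x) / real ?n)"
    proof (intro sum.cong refl)
      fix x assume "x \<in> set_mset e"
      have "{k \<in> {1..?n}. k \<le> count e x} = {1..count e x}"
        using count_le_size[of e x] by auto
      then show "(\<Sum>k\<in>{k \<in> {1..?n}. k \<le> count e x}. 1 / real ?n) = real (count e x) / real ?n"
        by simp
    qed
    also have "\<dots> = real (\<Sum>x\<in>set_mset e. count e x) / real ?n"
      by (simp add: sum_divide_distrib)
    also have "\<dots> = 1"
      using False by (simp add: size_multiset_overloaded_eq[symmetric])
    finally show ?thesis .
  qed
qed

lemma cont_replicate: "cont (replicate_mset k x) = Poly_Mapping.single x k"
  by (induction k) (auto simp: single_add[symmetric])

lemma psums_colourings: "0 \<notin> set l \<Longrightarrow> psums l (cont M) = int (card (colourings l M))"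
proof (induction l arbitrary: M)
  case Nil
  show ?case using cont_inject[of M "{#}"] by (simp add: psums_def mone_def colourings_Nil)
next
  case (Cons k l)
  then have k: "0 < k" by auto
  let ?X = "{x \<in> set_mset M. k \<le> count M x}"
  let ?f = "\<lambda>x. (Poly_Mapping.single x k, cont (M - replicate_mset k x))"
  \<comment> \<open>Positivity of \<open>k\<close> matters: \<open>single x 0\<close> would forget
    \<open>x\<close>.\<close>
  have inj: "inj_on ?f ?X"
    using k by (auto simp: inj_on_def) (metis keys_single less_numeral_extra(3) singleton_inject)
  have sub: "?f ` ?X \<subseteq> splits (cont M)"
    by (auto simp: cont_replicate[symmetric] cont_simps(3)[symmetric] cont_inject
        count_le_replicate_mset_subset_eq simp del: cont_simps)
  have rest: "psum k a * psums l b = 0" if "(a, b) \<in> splits (cont M) - ?f ` ?X" for a b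
  proof (rule ccontr)
    assume "psum k a * psums l b \<noteq> 0"
    then obtain x where a: "a = Poly_Mapping.single x k" by (auto simp: psum_def split: if_splits)
    obtain B where b: "b = cont B" using cont_surj by metis
    have "cont (replicate_mset k x + B) = cont M"
      using that by (simp add: a b cont_replicate)
    then have M: "M = replicate_mset k x + B" by (simp only: cont_inject)
    then have "x \<in> ?X" using k by (auto simp: count_greater_zero_iff[symmetric] simp del: count_greater_zero_iff)
    moreover have "(a, b) = ?f x" by (simp add: a b M)
    ultimately show False using that by blast
  qed
  have "psums (k # l) (cont M) = (\<Sum>z\<in>?f ` ?X. psum k (fst z) * psums l (snd z))"
    unfolding psums_Cons mmult_splits case_prod_unfold
  proof (rule sum.mono_neutral_right[OF finite_splits_monom sub], rule ballI)
    fix z assume "z \<in> splits (cont M) - ?f ` ?X"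
    then show "psum k (fst z) * psums l (snd z) = 0"
      using rest[of "fst z" "snd z"] by simp
  qed
  also have "\<dots> = (\<Sum>x\<in>?X. psum k (Poly_Mapping.single x k) * psums l (cont (M - replicate_mset k x)))"
    by (subst sum.reindex[OF inj]) simp
  also have "\<dots> = int (card (colourings (k # l) M))"
    using Cons k by (simp add: card_colourings_Cons psum_def) (auto intro!: sum.cong)
  finally show ?case .
qed

lemma image_mset_reps: "length xs = length l \<Longrightarrow> image_mset f (reps l xs) = reps l (map f xs)"
  unfolding reps_def by (induction xs l rule: list_induct2) auto

text \<open>Each tensor is counted as its weighted number of colourings, which is 1. A colouring by
  triples amounts to three independent colourings by their coordinates, so the sum over all tensors
  with given margins factorises.\<close>

lemma card_labelled_margins:
  "real (card (labelled margins (a, b) m)) =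
    (\<Sum>l\<in>comps (mdeg m). comp_weight l * real_of_int (psums l m * (psums l a * psums l b)))"
proof -
  obtain N where "Poly_Mapping.keys m \<subseteq> {..<N}" using keys_subset_lessThan_ex by blast
  then have fin: "finite (labelled margins (a, b) m)" using sum_schur_prod_prod by blast
  obtain A B M where [simp]: "a = cont A" "b = cont B" "m = cont M" using cont_surj by metis
  let ?X = "labelled margins (a, b) m"
  have count: "(\<Sum>E\<in>?X. card (colourings l E)) =
      card (colourings l A) * (card (colourings l B) * card (colourings l M))" if l: "0 \<notin> set l" for l
  proof -
    have "(\<Sum>E\<in>?X. card (colourings l E)) = card (\<Union>E\<in>?X. colourings l E)"
      using fin by (intro card_UN_disjoint[symmetric]) (auto simp: finite_colourings[OF l], auto simp: colourings_def)
    also have "\<dots> = card (colourings l A \<times> colourings l B \<times> colourings l M)"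
    proof (rule bij_betw_same_card, rule bij_betw_byWitness)
      let ?f = "\<lambda>xs. (map (fst \<circ> fst) xs, map (snd \<circ> fst) xs, map snd xs)"
      let ?g = "\<lambda>(as, bs, cs). zip (zip as bs) cs"
      show "\<forall>xs\<in>(\<Union>E\<in>?X. colourings l E). ?g (?f xs) = xs"
        by (auto simp: zip_map_map[symmetric] list_eq_iff_nth_eq)
      show "\<forall>y\<in>colourings l A \<times> colourings l B \<times> colourings l M. ?f (?g y) = y"
        by (auto simp: colourings_def list_eq_iff_nth_eq)
      show "?f ` (\<Union>E\<in>?X. colourings l E) \<subseteq> colourings l A \<times> colourings l B \<times> colourings l M"
        by (auto simp: colourings_def labelled_def margins_def cont_inject multiset.map_comp image_mset_reps)
      show "?g ` (colourings l A \<times> colourings l B \<times> colourings l M) \<subseteq> (\<Union>E\<in>?X. colourings l E)"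
        by (auto simp: colourings_def labelled_def margins_def cont_inject multiset.map_comp image_mset_reps
            map_fst_zip map_snd_zip simp flip: map_map)
    qed
    finally show ?thesis by (simp add: card_cartesian_product)
  qed
  have size: "size E = mdeg m" if "E \<in> ?X" for E
  proof -
    have "size E = mdeg (cont (image_mset snd E))" by (simp add: mdeg_cont)
    then show ?thesis using that by (simp add: labelled_def)
  qed
  have "real (card ?X) = (\<Sum>E\<in>?X. \<Sum>l\<in>comps (mdeg m). comp_weight l * real (card (colourings l E)))"
  proof -
    have "(\<Sum>l\<in>comps (mdeg m). comp_weight l * real (card (colourings l E))) = 1" if "E \<in> ?X" for E
      using sum_comp_weight_colourings[of E] size[OF that] by simp
    then show ?thesis by simp
  qed
  also have "\<dots> = (\<Sum>l\<in>comps (mdeg m). comp_weight l * real (\<Sum>E\<in>?X. card (colourings l E)))"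
    by (subst sum.swap) (simp add: sum_distrib_left)
  also have "\<dots> = (\<Sum>l\<in>comps (mdeg m). comp_weight l * real_of_int (psums l m * (psums l a * psums l b)))"
  proof (intro sum.cong refl)
    fix l assume "l \<in> comps (mdeg m)"
    then have l: "0 \<notin> set l" by (simp add: comps_def)
    show "comp_weight l * real (\<Sum>E\<in>?X. card (colourings l E)) =
        comp_weight l * real_of_int (psums l m * (psums l a * psums l b))"
      unfolding count[OF l] by (simp add: psums_colourings[OF l])
  qed
  finally show ?thesis .
qed

text \<open>This is \<open>1 / z\<^sub>\<rho>\<close>, but the value does not matter: the trace computation below works for
  any weights for which the following expansion holds.\<close>

definition part_weight :: "nat \<Rightarrow> nat list \<Rightarrow> real" where
  "part_weight n rho = (\<Sum>l\<in>{l \<in> comps n. rev (sort l) = rho}. comp_weight l)"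

text \<open>A product of power sums depends only on the multiset of its factors, so compositions are
  grouped by their sorted form.\<close>

lemma card_labelled_margins_parts:
  "real (card (labelled margins (a, b) m)) =
    (\<Sum>rho\<in>parts (mdeg m). part_weight (mdeg m) rho *
      (real_of_int (psums rho m) * (real_of_int (psums rho a) * real_of_int (psums rho b))))"
proof -
  let ?n = "mdeg m"
  have sort: "psums (rev (sort l)) = psums l" for l
    unfolding psums_def by (rule mprod_list_cong_mset) simp
  have img: "(\<lambda>l. rev (sort l)) ` comps ?n \<subseteq> parts ?n"
  proof -
    have "sum_list (sort l) = sum_list l" for l :: "nat list"
      by (metis mset_sort sum_mset_sum_list)
    then show ?thesis by (auto simp: comps_def parts_def is_partition_def sorted_wrt_rev)
  qed
  let ?h = "\<lambda>l. comp_weight l * (real_of_int (psums l m) * (real_of_int (psums l a) * real_of_int (psums l b)))"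
  have "real (card (labelled margins (a, b) m)) = (\<Sum>l\<in>comps ?n. ?h l)"
    by (simp add: card_labelled_margins)
  also have "\<dots> = (\<Sum>rho\<in>parts ?n. \<Sum>l\<in>{l \<in> comps ?n. rev (sort l) = rho}. ?h l)"
    by (rule sum.group[OF _ _ img, symmetric]) auto
  also have "\<dots> = (\<Sum>rho\<in>parts ?n. part_weight ?n rho *
      (real_of_int (psums rho m) * (real_of_int (psums rho a) * real_of_int (psums rho b))))"
    unfolding part_weight_def sum_distrib_right by (intro sum.cong refl) (auto simp: sort)
  finally show ?thesis .
qed

section \<open>Inverses over finite index sets, and unitriangular systems\<close>

section \<open>Linear algebra\<close>

text \<open>A one-sided inverse of a square matrix over a field is two-sided; an enumeration of
  \<open>I\<close> carries this over to sums.\<close>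

lemma sum_mult_inverse_commute:
  fixes A B :: "'a \<Rightarrow> 'a \<Rightarrow> 'b::field"
  assumes fin: "finite I"
    and AB: "\<And>i k. i \<in> I \<Longrightarrow> k \<in> I \<Longrightarrow> (\<Sum>j\<in>I. A i j * B j k) = (if i = k then 1 else 0)"
    and ik: "i \<in> I" "k \<in> I"
  shows "(\<Sum>j\<in>I. B i j * A j k) = (if i = k then 1 else 0)"
proof -
  let ?n = "card I"
  obtain h where h: "bij_betw h {0..<?n} I" using ex_bij_betw_nat_finite[OF fin] by blast
  have hI: "h x \<in> I" if "x < ?n" for x using h that by (auto simp: bij_betw_def)
  have h_eq: "h x = h y \<longleftrightarrow> x = y" if "x < ?n" "y < ?n" for x y
    using h that by (auto simp: bij_betw_def inj_on_def)
  define mt where "mt C = mat ?n ?n (\<lambda>(x, y). C (h x) (h y))" for C :: "'a \<Rightarrow> 'a \<Rightarrow> 'b"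
  have carrier: "mt C \<in> carrier_mat ?n ?n" for C by (simp add: mt_def)
  have entry: "(mt C * mt D) $$ (x, y) = (\<Sum>j\<in>I. C (h x) j * D j (h y))"
    if "x < ?n" "y < ?n" for C D x y
    using that
    by (simp add: mt_def scalar_prod_def sum.reindex_bij_betw[OF h, of "\<lambda>j. C (h x) j * D j (h y)", symmetric])
  have "mt A * mt B = 1\<^sub>m ?n"
    by (rule eq_matI) (use carrier in \<open>auto simp: entry AB hI h_eq simp del: index_mult_mat(1)\<close>)
  then have BA: "mt B * mt A = 1\<^sub>m ?n"
    by (rule mat_mult_left_right_inverse[OF carrier carrier])
  have "i \<in> h ` {0..<?n}" "k \<in> h ` {0..<?n}" using h ik by (simp_all add: bij_betw_def)
  then obtain x y where xy: "x < ?n" "i = h x" "y < ?n" "k = h y" by auto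
  have "(\<Sum>j\<in>I. B i j * A j k) = (mt B * mt A) $$ (x, y)" using xy by (simp add: entry)
  then show ?thesis using xy by (simp add: BA h_eq)
qed

text \<open>Moves the changes of basis \<open>p\<close> and \<open>q\<close> in and out of a
  weighted Gram matrix.\<close>

lemma sum_bilinear:
  fixes w :: "'x \<Rightarrow> 'b::comm_ring_1"
  shows "(\<Sum>x\<in>X. w x * ((\<Sum>a\<in>I. u x a * p a) * (\<Sum>b\<in>I. u x b * q b))) =
    (\<Sum>a\<in>I. \<Sum>b\<in>I. p a * q b * (\<Sum>x\<in>X. w x * (u x a * u x b)))"
proof -
  have "(\<Sum>x\<in>X. w x * ((\<Sum>a\<in>I. u x a * p a) * (\<Sum>b\<in>I. u x b * q b))) =
      (\<Sum>x\<in>X. \<Sum>a\<in>I. \<Sum>b\<in>I. p a * q b * (w x * (u x a * u x b)))"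
    unfolding sum_product by (simp add: sum_distrib_left mult_ac)
  also have "\<dots> = (\<Sum>a\<in>I. \<Sum>x\<in>X. \<Sum>b\<in>I. p a * q b * (w x * (u x a * u x b)))"
    by (rule sum.swap)
  also have "\<dots> = (\<Sum>a\<in>I. \<Sum>b\<in>I. \<Sum>x\<in>X. p a * q b * (w x * (u x a * u x b)))"
    by (intro sum.cong refl sum.swap)
  finally show ?thesis by (simp add: sum_distrib_left)
qed

context
  fixes I :: "'a set" and r :: "'a \<Rightarrow> nat" and K :: "'a \<Rightarrow> 'a \<Rightarrow> int"
  assumes fin: "finite I"
    and triangular: "\<And>l a. l \<in> I \<Longrightarrow> a \<in> I \<Longrightarrow> K l a \<noteq> 0 \<Longrightarrow> r l < r a \<or> l = a"
    and diagonal: "\<And>a. a \<in> I \<Longrightarrow> K a a = 1"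
begin

lemma unitriangular_sum:
  assumes a: "a \<in> I"
  shows "(\<Sum>l\<in>I. c l * K l a) = c a + (\<Sum>l\<in>{l \<in> I. r l < r a}. c l * K l a)"
proof -
  have "(\<Sum>l\<in>I. c l * K l a) = (\<Sum>l\<in>insert a {l \<in> I. r l < r a}. c l * K l a)"
    using a triangular[OF _ a] fin by (intro sum.mono_neutral_right) auto
  then show ?thesis using fin a by (simp add: diagonal)
qed

text \<open>Substitution by increasing rank; the diagonal entries 1 keep the solution
  integral.\<close>

lemma unitriangular_solvable: "\<exists>c. \<forall>a\<in>I. (\<Sum>l\<in>I. c l * K l a) = f a"
proof -
  have "\<exists>c. \<forall>a\<in>I. r a < N \<longrightarrow> (\<Sum>l\<in>I. c l * K l a) = f a" for N
  proof (induction N)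
    case (Suc N)
    then obtain c where c: "\<And>a. a \<in> I \<Longrightarrow> r a < N \<Longrightarrow> (\<Sum>l\<in>I. c l * K l a) = f a" by blast
    \<comment> \<open>Values of rank below \<open>N\<close> are kept, and those of rank
      \<open>N\<close> are set to solve their own equation, which by triangularity involves only
      smaller ranks besides.\<close>
    define c' where "c' l = (if r l < N then c l else f l - (\<Sum>x\<in>{x \<in> I. r x < r l}. c x * K x l))" for l
    have "(\<Sum>l\<in>I. c' l * K l a) = f a" if a: "a \<in> I" "r a < Suc N" for a
    proof -
      have "(\<Sum>l\<in>{l \<in> I. r l < r a}. c' l * K l a) = (\<Sum>l\<in>{l \<in> I. r l < r a}. c l * K l a)"
        using a by (intro sum.cong) (auto simp: c'_def)
      then show ?thesis
        using a c[of a] unitriangular_sum[OF a(1), of c] unitriangular_sum[OF a(1), of c']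
        by (cases "r a < N") (auto simp: c'_def)
    qed
    then show ?case by blast
  qed simp
  from this[of "Suc (Max (r ` I))"] show ?thesis
    using fin by (auto simp: less_Suc_eq_le)
qed

lemma unitriangular_unique:
  assumes eq: "\<And>a. a \<in> I \<Longrightarrow> (\<Sum>l\<in>I. c l * K l a) = (\<Sum>l\<in>I. c' l * K l a)"
  shows "a \<in> I \<Longrightarrow> c a = c' a"
proof (induction "r a" arbitrary: a rule: less_induct)
  case less
  then have "(\<Sum>l\<in>{l \<in> I. r l < r a}. c l * K l a) = (\<Sum>l\<in>{l \<in> I. r l < r a}. c' l * K l a)"
    by (intro sum.cong) auto
  then show ?case
    using eq[of a] less.prems unitriangular_sum[of a c] unitriangular_sum[of a c'] by simp
qed

end

section \<open>Linear systems given by the Kostka matrix\<close>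

lemma kostka_triangular:
  "lam \<in> parts n \<Longrightarrow> al \<in> parts n \<Longrightarrow> schur lam (pmon al) \<noteq> 0 \<Longrightarrow>
    wt (pmon lam) < wt (pmon al) \<or> lam = al"
  by (rule schur_pmon_triangular) (auto simp: parts_def)

lemma kostka_diagonal: "lam \<in> parts n \<Longrightarrow> schur lam (pmon lam) = 1"
  by (rule schur_pmon_self) (auto simp: parts_def)

lemma kostka_solvable: "\<exists>c. \<forall>al\<in>parts n. (\<Sum>lam\<in>parts n. c lam * schur lam (pmon al)) = f al"
  using kostka_triangular kostka_diagonal
  by (intro unitriangular_solvable[where r = "\<lambda>lam. wt (pmon lam)"]) auto

lemma kostka_unique:
  assumes "\<And>al. al \<in> parts n \<Longrightarrow>
      (\<Sum>lam\<in>parts n. c lam * schur lam (pmon al)) = (\<Sum>lam\<in>parts n. c' lam * schur lam (pmon al))"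
    and "al \<in> parts n"
  shows "c al = c' al"
  using assms(2) kostka_triangular kostka_diagonal
  by (intro unitriangular_unique[where r = "\<lambda>lam. wt (pmon lam)" and
      K = "\<lambda>lam al. schur lam (pmon al)", OF _ _ _ assms(1)]) auto

section \<open>Existence and uniqueness of Schur expansions, and evaluation of
  \<open>gen_lr\<close>\<close>

section \<open>Littlewood--Richardson coefficients\<close>

text \<open>The condition under the \<open>THE\<close> in \<open>gen_lr\<close>, for an arbitrary
  series.\<close>

definition schur_expansion :: "mfps \<Rightarrow> (nat list \<Rightarrow> int) \<Rightarrow> bool" where
  "schur_expansion f c \<longleftrightarrow> (\<forall>nu. c nu \<noteq> 0 \<longrightarrow> is_partition nu) \<and> finite {nu. c nu \<noteq> 0} \<and>
     f = (\<lambda>m. \<Sum>nu\<in>{nu. c nu \<noteq> 0}. c nu * schur nu m)"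

text \<open>Schur functions of size other than \<open>k\<close> vanish at a monomial of degree
  \<open>k\<close>, which leaves a finite Kostka system.\<close>

lemma schur_expansion_at_pmon:
  assumes "schur_expansion f c" "al \<in> parts k"
  shows "f (pmon al) = (\<Sum>lam\<in>parts k. c lam * schur lam (pmon al))"
proof -
  have deg: "mdeg (pmon al) = k" using assms(2) by (simp add: mdeg_pmon parts_def)
  have "f (pmon al) = (\<Sum>nu\<in>{nu. c nu \<noteq> 0}. c nu * schur nu (pmon al))"
    using assms(1) unfolding schur_expansion_def by metis
  also have "\<dots> = (\<Sum>nu\<in>{nu. c nu \<noteq> 0} \<inter> parts k. c nu * schur nu (pmon al))"
  proof (rule sum.mono_neutral_right)
    show "\<forall>nu\<in>{nu. c nu \<noteq> 0} - {nu. c nu \<noteq> 0} \<inter> parts k. c nu * schur nu (pmon al) = 0"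
    proof
      fix nu assume "nu \<in> {nu. c nu \<noteq> 0} - {nu. c nu \<noteq> 0} \<inter> parts k"
      then have "sum_list nu \<noteq> k"
        using assms(1) by (auto simp: schur_expansion_def parts_def)
      then show "c nu * schur nu (pmon al) = 0"
        using homogD[OF homog_schur, of "pmon al" nu] deg by simp
    qed
  qed (use assms(1) in \<open>auto simp: schur_expansion_def\<close>)
  also have "\<dots> = (\<Sum>lam\<in>parts k. c lam * schur lam (pmon al))"
    by (rule sum.mono_neutral_left) auto
  finally show ?thesis .
qed

lemma schur_expansion_unique:
  assumes c: "schur_expansion f c" and c': "schur_expansion f c'"
  shows "c = c'"
proof
  fix nu
  show "c nu = c' nu"
  proof (cases "is_partition nu")
    case True
    then have nu: "nu \<in> parts (sum_list nu)" by (simp add: parts_def)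
    show ?thesis
      by (rule kostka_unique[OF _ nu])
         (simp flip: schur_expansion_at_pmon[OF c] schur_expansion_at_pmon[OF c'])
  next
    case False
    then show ?thesis using c c' by (metis schur_expansion_def)
  qed
qed

text \<open>The coefficients are solved for at partition exponents; both sides are symmetric and
  homogeneous, hence agree everywhere.\<close>

lemma schur_expansion_exists:
  assumes f: "symm f" "homog n f"
  obtains c where "schur_expansion f c" "\<And>nu. nu \<notin> parts n \<Longrightarrow> c nu = 0"
proof -
  obtain c where c: "\<And>al. al \<in> parts n \<Longrightarrow> (\<Sum>lam\<in>parts n. c lam * schur lam (pmon al)) = f (pmon al)"
    using kostka_solvable[where f = "\<lambda>al. f (pmon al)"] by blast
  define c0 where "c0 nu = (if nu \<in> parts n then c nu else 0)" for nu
  have sub: "{nu. c0 nu \<noteq> 0} \<subseteq> parts n" by (auto simp: c0_def)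
  have "f m = (\<Sum>nu\<in>{nu. c0 nu \<noteq> 0}. c0 nu * schur nu m)" for m
  proof -
    have "(\<Sum>nu\<in>{nu. c0 nu \<noteq> 0}. c0 nu * schur nu m) = (\<Sum>nu\<in>parts n. c0 nu * schur nu m)"
      using sub by (intro sum.mono_neutral_left) auto
    also have "\<dots> = (\<Sum>nu\<in>parts n. c nu * schur nu m)"
      by (rule sum.cong) (auto simp: c0_def)
    also have "\<dots> = f m"
    proof (cases "mdeg m = n")
      case True
      obtain al where al: "al \<in> parts (mdeg m)" and eq: "\<forall>f. symm f \<longrightarrow> f m = f (pmon al)"
        using symm_eq_at_partition by blast
      have "(\<Sum>nu\<in>parts n. c nu * schur nu m) = (\<Sum>nu\<in>parts n. c nu * schur nu (pmon al))"
        by (intro sum.cong refl) (simp add: eq[rule_format, OF symm_schur] parts_def)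
      also have "\<dots> = f (pmon al)" using c al True by simp
      also have "\<dots> = f m" by (rule eq[rule_format, OF f(1), symmetric])
      finally show ?thesis .
    next
      case False
      then have "schur nu m = 0" if "nu \<in> parts n" for nu
        using that by (intro homogD[OF homog_schur]) (auto simp: parts_def)
      then show ?thesis using homogD[OF f(2) False] by simp
    qed
    finally show ?thesis by simp
  qed
  moreover have "finite {nu. c0 nu \<noteq> 0}" using sub finite_subset by blast
  moreover have "is_partition nu" if "c0 nu \<noteq> 0" for nu
    using that by (auto simp: c0_def parts_def split: if_splits)
  ultimately have "schur_expansion f c0"
    unfolding schur_expansion_def by blast
  then show ?thesis by (rule that) (simp add: c0_def)
qed

lemma part_seqs_Nil:
  assumes "mus \<in> part_seqs m" "j \<notin> Poly_Mapping.keys m"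
  shows "mus j = []"
  using assms by (auto simp: part_seqs_def in_keys_iff parts_0 dest: spec[of _ j])

lemma schur_prod_seq_len:
  assumes mus: "\<And>j. j \<ge> N \<Longrightarrow> mus j = []"
  shows "mprod_list (map (\<lambda>j. schur (mus j)) [0..<seq_len mus]) = schur_prod N mus"
proof -
  let ?L = "seq_len mus"
  have le: "?L \<le> N" unfolding seq_len_def using mus by (intro Least_le) simp
  have nil: "\<forall>j\<ge>?L. mus j = []"
    unfolding seq_len_def using mus by (intro LeastI[of "\<lambda>N. \<forall>j\<ge>N. mus j = []" N]) simp
  have "mprod_list (map (\<lambda>j. schur (mus j)) [?L..<M]) = mone" for M
  proof -
    have "map (\<lambda>j. schur (mus j)) [?L..<M] = map (\<lambda>_. mone) [?L..<M]"
      using nil by (simp add: schur_Nil)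
    moreover have "mprod_list (map (\<lambda>_. mone) xs) = mone" for xs :: "nat list"
      by (induction xs) auto
    ultimately show ?thesis by (simp only:)
  qed
  moreover have "[0..<N] = [0..<?L] @ [?L..<N]" using le by (metis le0 le_Suc_ex upt_add_eq_append)
  ultimately show ?thesis by (simp add: schur_prod_def mprod_list_append)
qed

lemma
  assumes mus: "mus \<in> part_seqs m" and N: "Poly_Mapping.keys m \<subseteq> {..<N}"
  shows symm_schur_prod: "symm (schur_prod N mus)"
    and homog_schur_prod: "homog (mdeg m) (schur_prod N mus)"
proof -
  have mus': "mus j \<in> parts (Poly_Mapping.lookup m j)" for j using mus by (simp add: part_seqs_def)
  show "symm (schur_prod N mus)"
    unfolding schur_prod_def using mus'
    by (intro symm_mprod_list) (auto simp: parts_def intro!: symm_schur)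
  have "homog (sum_list (map (\<lambda>j. sum_list (mus j)) [0..<N])) (schur_prod N mus)"
    unfolding schur_prod_def
    by (rule homog_mprod_list) (simp add: list_all2_map1 list_all2_map2 list.rel_refl homog_schur)
  moreover have "sum_list (map (\<lambda>j. sum_list (mus j)) [0..<N]) = mdeg m"
    using mus' N by (simp add: mdeg_superset[of "{..<N}"] parts_def interv_sum_list_conv_sum_set_nat atLeast0LessThan)
  ultimately show "homog (mdeg m) (schur_prod N mus)" by simp
qed

text \<open>Existence and uniqueness of the expansion evaluate the \<open>THE\<close>, and
  homogeneity confines its coefficients to partitions of \<open>mdeg m\<close>.\<close>

lemma
  assumes mus: "mus \<in> part_seqs m" and N: "Poly_Mapping.keys m \<subseteq> {..<N}"
  shows gen_lr_eq_0: "lam \<notin> parts (mdeg m) \<Longrightarrow> gen_lr lam mus = 0"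
    and schur_prod_pmon: "al \<in> parts (mdeg m) \<Longrightarrow>
      schur_prod N mus (pmon al) = (\<Sum>lam\<in>parts (mdeg m). gen_lr lam mus * schur lam (pmon al))"
proof -
  obtain c where c: "schur_expansion (schur_prod N mus) c" "\<And>nu. nu \<notin> parts (mdeg m) \<Longrightarrow> c nu = 0"
    using schur_expansion_exists[OF symm_schur_prod[OF assms] homog_schur_prod[OF assms]] by blast
  have "mus j = []" if "j \<ge> N" for j
    using that N by (intro part_seqs_Nil[OF mus]) auto
  then have prod: "mprod_list (map (\<lambda>j. schur (mus j)) [0..<seq_len mus]) = schur_prod N mus"
    by (rule schur_prod_seq_len)
  have "gen_lr lam mus = (THE c. schur_expansion (schur_prod N mus) c) lam" for lam
    unfolding gen_lr_def schur_expansion_def prod by (rule refl)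
  moreover have "(THE c. schur_expansion (schur_prod N mus) c) = c"
    using c(1) by (intro the_equality schur_expansion_unique)
  ultimately have gen_lr: "gen_lr lam mus = c lam" for lam by simp
  show "lam \<notin> parts (mdeg m) \<Longrightarrow> gen_lr lam mus = 0" by (simp add: gen_lr c(2))
  show "al \<in> parts (mdeg m) \<Longrightarrow>
      schur_prod N mus (pmon al) = (\<Sum>lam\<in>parts (mdeg m). gen_lr lam mus * schur lam (pmon al))"
    using schur_expansion_at_pmon[OF c(1)] by (simp add: gen_lr)
qed

section \<open>Orthogonality relations and the sum of squares\<close>

section \<open>The trace computation\<close>

text \<open>A power of a single variable arises in only one way: variable \<open>i\<close> is picked
  from every factor.\<close>

lemma psums_single:
  assumes "rho \<in> parts n"
  shows "psums rho (Poly_Mapping.single i n) = 1"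
proof -
  have "card (colourings l (replicate_mset (sum_list l) i)) = 1" if "0 \<notin> set l" for l
    using that
  proof (induction l)
    case (Cons k l)
    then have k: "0 < k" "0 \<notin> set l" by auto
    have "{x \<in> set_mset (replicate_mset (sum_list (k # l)) i).
        k \<le> count (replicate_mset (sum_list (k # l)) i) x} = {i}"
      using k by auto
    moreover have "replicate_mset (k + sum_list l) i - replicate_mset k i = replicate_mset (sum_list l) i"
      by (simp add: multiset_eq_iff)
    ultimately show ?case using k Cons.IH by (simp add: card_colourings_Cons)
  qed (simp add: colourings_Nil)
  then show ?thesis
    using assms psums_colourings[of rho "replicate_mset n i"]
    by (auto simp: parts_def is_partition_def cont_replicate)
qed

text \<open>The tensor count at a power of variable 0, where only one partition is nonempty and all
  coefficients \<open>psums rho ?m\<close> are 1.\<close>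

lemma sum_schur_schur:
  "real_of_int (\<Sum>mu\<in>parts n. schur mu a * schur mu b) =
    (\<Sum>rho\<in>parts n. part_weight n rho * (real_of_int (psums rho a) * real_of_int (psums rho b)))"
proof -
  let ?m = "(0 :: monom) + Poly_Mapping.single 0 n"
  have keys: "Poly_Mapping.keys (0 :: monom) \<subseteq> {..<0}" by simp
  have "part_seqs 0 = {\<lambda>_. []}" by (auto simp: part_seqs_def parts_0)
  then have "(\<Sum>mu\<in>parts n. schur mu a * schur mu b) =
      (\<Sum>mus\<in>part_seqs ?m. schur_prod (Suc 0) mus a * schur_prod (Suc 0) mus b)"
    unfolding sum_part_seqs_step[OF keys] schur_prod_upd by (simp add: schur_prod_def)
  also have "\<dots> = int (card (labelled margins (a, b) ?m))"
    using sum_schur_prod_prod[of ?m "Suc 0"] by (auto split: if_splits)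
  finally show ?thesis
    by (simp add: card_labelled_margins_parts psums_single)
qed

lemma sum_gen_lr_squares:
  "(\<Sum>lam\<in>parts (mdeg m). \<Sum>mus\<in>part_seqs m. (gen_lr lam mus)\<^sup>2) = (\<Sum>rho\<in>parts (mdeg m). psums rho m)"
proof -
  let ?n = "mdeg m" and ?I = "parts (mdeg m)"
  obtain N where N: "Poly_Mapping.keys m \<subseteq> {..<N}" using keys_subset_lessThan_ex by blast
  define K where "K lam al = real_of_int (schur lam (pmon al))" for lam al
  define R where "R rho al = real_of_int (psums rho (pmon al))" for rho al
  define Y where "Y = part_weight ?n"
  \<comment> \<open>Unit vectors as right-hand sides produce the rows of a left inverse of the
    Kostka matrix.\<close>
  have "\<exists>c. \<forall>be\<in>?I. (\<Sum>lam\<in>?I. c lam * schur lam (pmon be)) = (if al = be then 1 else 0)" for al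
    by (rule kostka_solvable)
  then obtain J where J: "\<And>al be. be \<in> ?I \<Longrightarrow> (\<Sum>lam\<in>?I. J al lam * schur lam (pmon be)) = (if al = be then 1 else 0)"
    by metis
  define K' where "K' al lam = real_of_int (J al lam)" for al lam
  have "(\<Sum>lam\<in>?I. K' al lam * K lam be) = (if al = be then 1 else 0)" if "al \<in> ?I" "be \<in> ?I" for al be
    using arg_cong[OF J[OF that(2), of al], of real_of_int] by (simp add: K_def K'_def)
  \<comment> \<open>Extracting Schur coefficients uses this inverse on the right.\<close>
  then have KK': "(\<Sum>al\<in>?I. K lam al * K' al mu) = (if lam = mu then 1 else 0)"
    if "lam \<in> ?I" "mu \<in> ?I" for lam mu
    using sum_mult_inverse_commute[OF finite_parts, of ?n K' K] that by blast
  text \<open>\<open>B rho lam\<close> is the value of the irreducible character \<open>lam\<close> at cycle type \<open>rho\<close>. Only the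
    first orthogonality relation is computed; the second one follows because \<open>B\<close> is square.\<close>
  define B where "B rho lam = (\<Sum>al\<in>?I. R rho al * K' al lam)" for rho lam
  \<comment> \<open>The factor 1 is the unit weight in the form expected by
    \<open>sum_bilinear\<close>.\<close>
  have M: "(\<Sum>kap\<in>?I. 1 * (K kap al * K kap be)) = (\<Sum>rho\<in>?I. Y rho * (R rho al * R rho be))" for al be
    using sum_schur_schur[of "pmon al" "pmon be" ?n] by (simp add: K_def R_def Y_def)
  have first: "(\<Sum>rho\<in>?I. Y rho * B rho lam * B rho mu) = (if lam = mu then 1 else 0)"
    if "lam \<in> ?I" "mu \<in> ?I" for lam mu
  proof -
    have "(\<Sum>rho\<in>?I. Y rho * B rho lam * B rho mu) =
        (\<Sum>al\<in>?I. \<Sum>be\<in>?I. K' al lam * K' be mu * (\<Sum>rho\<in>?I. Y rho * (R rho al * R rho be)))"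
      unfolding B_def mult.assoc[of "Y _"] by (rule sum_bilinear)
    also have "\<dots> = (\<Sum>kap\<in>?I. 1 * ((\<Sum>al\<in>?I. K kap al * K' al lam) * (\<Sum>be\<in>?I. K kap be * K' be mu)))"
      unfolding M[symmetric] by (rule sum_bilinear[symmetric])
    also have "\<dots> = (\<Sum>kap\<in>?I. if kap = lam then if lam = mu then 1 else 0 else 0)"
      by (rule sum.cong) (auto simp: KK' that)
    also have "\<dots> = (if lam = mu then 1 else 0)"
      using that by simp
    finally show ?thesis .
  qed
  \<comment> \<open>The weight stays with one factor: the transpose of
    \<open>Y rho * B rho lam\<close> is a left inverse of \<open>B\<close>, hence a right inverse,
    and the diagonal entry at \<open>rho\<close> is taken.\<close>
  have second: "(\<Sum>lam\<in>?I. B rho lam * (Y rho * B rho lam)) = 1" if "rho \<in> ?I" for rho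
    using sum_mult_inverse_commute[OF finite_parts, of ?n "\<lambda>lam rho. Y rho * B rho lam" B rho rho] first that
    by simp
  \<comment> \<open>Multiplying the expansion at partition exponents by the inverse Kostka matrix
    isolates one coefficient.\<close>
  have gen_lr: "real_of_int (gen_lr lam mus) =
      (\<Sum>al\<in>?I. real_of_int (schur_prod N mus (pmon al)) * K' al lam)"
    if "lam \<in> ?I" "mus \<in> part_seqs m" for lam mus
  proof -
    have "(\<Sum>al\<in>?I. real_of_int (schur_prod N mus (pmon al)) * K' al lam) =
        (\<Sum>al\<in>?I. \<Sum>mu\<in>?I. real_of_int (gen_lr mu mus) * (K mu al * K' al lam))"
      by (rule sum.cong) (auto simp: schur_prod_pmon[OF that(2) N] K_def sum_distrib_right mult.assoc)
    also have "\<dots> = (\<Sum>mu\<in>?I. real_of_int (gen_lr mu mus) * (\<Sum>al\<in>?I. K mu al * K' al lam))"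
      by (subst sum.swap) (simp add: sum_distrib_left)
    also have "\<dots> = (\<Sum>mu\<in>?I. if mu = lam then real_of_int (gen_lr mu mus) else 0)"
      by (rule sum.cong) (auto simp: KK' that)
    also have "\<dots> = real_of_int (gen_lr lam mus)"
      using that by simp
    finally show ?thesis by simp
  qed
  have tensor: "(\<Sum>mus\<in>part_seqs m. 1 * (real_of_int (schur_prod N mus (pmon al)) * real_of_int (schur_prod N mus (pmon be)))) =
      (\<Sum>rho\<in>?I. Y rho * real_of_int (psums rho m) * (R rho al * R rho be))" for al be
  proof -
    have "(\<Sum>mus\<in>part_seqs m. 1 * (real_of_int (schur_prod N mus (pmon al)) * real_of_int (schur_prod N mus (pmon be)))) =
        real_of_int (\<Sum>mus\<in>part_seqs m. schur_prod N mus (pmon al) * schur_prod N mus (pmon be))"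
      by simp
    also have "\<dots> = real (card (labelled margins (pmon al, pmon be) m))"
      using sum_schur_prod_prod[OF N, of "pmon al" "pmon be"] by simp
    finally show ?thesis
      unfolding card_labelled_margins_parts by (simp add: Y_def R_def mult.assoc)
  qed
  have "(\<Sum>mus\<in>part_seqs m. (real_of_int (gen_lr lam mus))\<^sup>2) =
      (\<Sum>rho\<in>?I. Y rho * real_of_int (psums rho m) * (B rho lam * B rho lam))" if "lam \<in> ?I" for lam
  proof -
    have "(\<Sum>mus\<in>part_seqs m. (real_of_int (gen_lr lam mus))\<^sup>2) =
        (\<Sum>mus\<in>part_seqs m. 1 * ((\<Sum>al\<in>?I. real_of_int (schur_prod N mus (pmon al)) * K' al lam) *
          (\<Sum>be\<in>?I. real_of_int (schur_prod N mus (pmon be)) * K' be lam)))"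
      by (rule sum.cong) (simp_all add: gen_lr that power2_eq_square)
    also have "\<dots> = (\<Sum>al\<in>?I. \<Sum>be\<in>?I. K' al lam * K' be lam *
        (\<Sum>rho\<in>?I. Y rho * real_of_int (psums rho m) * (R rho al * R rho be)))"
      unfolding tensor[symmetric] by (rule sum_bilinear)
    also have "\<dots> = (\<Sum>rho\<in>?I. Y rho * real_of_int (psums rho m) * (B rho lam * B rho lam))"
      unfolding B_def by (rule sum_bilinear[symmetric])
    finally show ?thesis .
  qed
  then have "(\<Sum>lam\<in>?I. \<Sum>mus\<in>part_seqs m. (real_of_int (gen_lr lam mus))\<^sup>2) =
      (\<Sum>lam\<in>?I. \<Sum>rho\<in>?I. real_of_int (psums rho m) * (B rho lam * (Y rho * B rho lam)))"
    by (simp add: mult_ac)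
  \<comment> \<open>With \<open>rho\<close> outermost, the inner sum over \<open>lam\<close> is the
    diagonal entry computed in \<open>second\<close>.\<close>
  also have "\<dots> = (\<Sum>rho\<in>?I. real_of_int (psums rho m) * (\<Sum>lam\<in>?I. B rho lam * (Y rho * B rho lam)))"
    by (subst sum.swap) (simp add: sum_distrib_left)
  also have "\<dots> = real_of_int (\<Sum>rho\<in>?I. psums rho m)"
    by (simp add: second)
  finally have "real_of_int (\<Sum>lam\<in>?I. \<Sum>mus\<in>part_seqs m. (gen_lr lam mus)\<^sup>2) = real_of_int (\<Sum>rho\<in>?I. psums rho m)"
    by simp
  then show ?thesis by (simp only: of_int_eq_iff)
qed

theorem theorem1:
  "mprod_inf (\<lambda>k. minv (msub mone (psum k))) =
   (\<lambda>m. \<Sum>(lam, mus) \<in> {(lam, mus). is_partition lam \<and> (\<forall>j. is_partition (mus j)) \<and>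
          finite {j. mus j \<noteq> []} \<and> (\<forall>j. sum_list (mus j) = Poly_Mapping.lookup m j) \<and>
          gen_lr lam mus \<noteq> 0}.
        (gen_lr lam mus)^2)"
proof
  fix m
  let ?S = "{(lam, mus). is_partition lam \<and> (\<forall>j. is_partition (mus j)) \<and>
      finite {j. mus j \<noteq> []} \<and> (\<forall>j. sum_list (mus j) = Poly_Mapping.lookup m j) \<and> gen_lr lam mus \<noteq> 0}"
  obtain N where N: "Poly_Mapping.keys m \<subseteq> {..<N}" using keys_subset_lessThan_ex by blast
  have seqs: "(\<forall>j. is_partition (mus j)) \<and> finite {j. mus j \<noteq> []} \<and>
      (\<forall>j. sum_list (mus j) = Poly_Mapping.lookup m j) \<longleftrightarrow> mus \<in> part_seqs m" for mus
  proof -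
    have "finite {j. mus j \<noteq> []}" if "mus \<in> part_seqs m"
      using part_seqs_Nil[OF that] by (intro finite_subset[OF _ finite_keys[of m]]) blast
    then show ?thesis by (auto simp: part_seqs_def parts_def)
  qed
  \<comment> \<open>A nonzero coefficient forces \<open>lam\<close> to have size
    \<open>mdeg m\<close>, so the index set lies in a finite product; the remaining pairs of that
    product contribute 0.\<close>
  have "?S = {x \<in> parts (mdeg m) \<times> part_seqs m. gen_lr (fst x) (snd x) \<noteq> 0}"
  proof (rule Set.set_eqI)
    fix x :: "nat list \<times> (nat \<Rightarrow> nat list)"
    obtain lam mus where [simp]: "x = (lam, mus)" by (cases x)
    have "x \<in> ?S \<longleftrightarrow> is_partition lam \<and> mus \<in> part_seqs m \<and> gen_lr lam mus \<noteq> 0"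
      using seqs[of mus] by auto
    also have "\<dots> \<longleftrightarrow> x \<in> {x \<in> parts (mdeg m) \<times> part_seqs m. gen_lr (fst x) (snd x) \<noteq> 0}"
      using gen_lr_eq_0[OF _ N, of mus lam] by (auto simp: parts_def)
    finally show "x \<in> ?S \<longleftrightarrow> x \<in> {x \<in> parts (mdeg m) \<times> part_seqs m. gen_lr (fst x) (snd x) \<noteq> 0}" .
  qed
  then have "(\<Sum>(lam, mus)\<in>?S. (gen_lr lam mus)\<^sup>2) =
      (\<Sum>(lam, mus)\<in>parts (mdeg m) \<times> part_seqs m. (gen_lr lam mus)\<^sup>2)"
    by (intro sum.mono_neutral_left) auto
  also have "\<dots> = mprod_inf (\<lambda>k. minv (msub mone (psum k))) m"
    by (simp add: sum.cartesian_product[symmetric] sum_gen_lr_squares mprod_inf_psum)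
  finally show "mprod_inf (\<lambda>k. minv (msub mone (psum k))) m = (\<Sum>(lam, mus)\<in>?S. (gen_lr lam mus)^2)" ..
qed

end
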